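(* Let $k$ be a field and $R=k[X_1,\dots,X_n]$ with the standard grading over $G=\mathbb Z^n$. Let $M$ be a graded $R$-module that is finitely generated and finitely supported. Write $d_g=\dim_kM_g$ for $g\in G$, and let $$I=J=\bigcup_{g\in\operatorname{supp}M}\{g\}\times\{1,\dots,d_g\}.$$ Choose for every $g\in\operatorname{supp}M$ a basis $(e_{(g,1)},\dots,e_{(g,d_g)})$ of the $k$-vector space $M_g$. Consider the monomial matrix $A=[a_{(g,\mu)(h,\nu)}]_{(g,\mu)\in I,\,(h,\nu)\in J}$ with cogenerator degrees $(g)_{(g,\mu)\in I}$ and generator degrees $(h)_{(h,\nu)\in J}$ defined as follows: for $(g,\mu)\in I$ and $(h,\nu)\in J$ with $h\le g$, let $a_{(g,\mu)(h,\nu)}$ be the $\mu$-th coefficient of $X^{g-h}\cdot e_{(h,\nu)}$ in $M_g$ with respect to the chosen basis, i.e. $$X^{g-h}\cdot e_{(h,\nu)}=a_{(g,1)(h,\nu)}e_{(g,1)}+\dots+a_{(g,d_g)(h,\nu)}e_{(g,d_g)};$$ for all other $(g,\mu)\in I$, $(h,\nu)\in J$ let $a_{(g,\mu)(h,\nu)}=0$. Then the monomial matrix $A$ represents the associated free-cofree presentation $\varphi_M\colon F_M\to E_M$ of $M$.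
   Context: The standard grading on $R=k[X_1,\dots,X_n]$ is the $\mathbb Z^n$-grading with $R=\bigoplus_{\alpha\in\mathbb N^n}kX^\alpha$. $\mathbb Z^n$ carries the componentwise partial order. $\operatorname{supp}M=\{a\in G\mid M_a\ne0\}$, and $M$ is finitely supported if this set is finite. $(\Sigma^gM)_a=M_{a-g}$. $\operatorname{Hom}_R$ denotes graded degree-$0$ homomorphisms, $\hom_R(M,N)=\bigoplus_a\operatorname{Hom}_R(\Sigma^aM,N)$, and $M^\vee=\hom_R(M,E(k))$ is the Matlis dual, with $E(k)$ the graded injective hull of $k=R/(X_1,\dots,X_n)$. One has $M^\vee_{a}\cong\operatorname{Hom}_k(M_{-a},k)$. The module $R^\vee$ has a copy of $k$ in each degree of $-\mathbb N^n$ (in degree $a$ generated by the functional on $R_{-a}$ dual to $X^{-a}$) and is zero elsewhere; $X^\beta$ acts from degree $a$ to $a+\beta$ as the identity of $k$ if $a+\beta\in-\mathbb N^n$, and as $0$ otherwise. Associated presentation: $F_M=\bigoplus_{g\in G}\Sigma^gR\otimes_kM_g$ and $E_M=\prod_{h\in G}\operatorname{Hom}_k(M^\vee_h,\Sigma^{-h}R^\vee)$ (the vector spaces $M_g$, $M_h^\vee$ are placed in degree $0$, so $\operatorname{Hom}_k(V,N)$ has degree-$a$ part $\operatorname{Hom}_k(V,N_a)$; the product is degreewise). $\hat\varphi_M\colon F_M\to M$ is induced by $r\otimes m\mapsto rm$; $\check\varphi_M\colon M^{\vee\vee}\to E_M$ is induced by $f''\mapsto(f'\mapsto(r\mapsto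 r\cdot f''(f')))$ for $f''\in M^{\vee\vee}$, $f'\in M^\vee_h$, $r\in R$ (viewed in $\Sigma^hR$); $u_M\colon M\to M^{\vee\vee}$, $u_M(m)(f')=f'(m)$; and $\varphi_M=\check\varphi_M\circ u_M\circ\hat\varphi_M$. It is a free-cofree presentation for $M$, meaning a graded degree-$0$ homomorphism from a graded free module to the Matlis dual of a graded free module (the latter being graded injective) with image isomorphic to $M$. A monomial matrix with cogenerator degrees $(\alpha_i)_{i\in I}$ and generator degrees $(\beta_j)_{j\in J}$ (finite families in $\mathbb Z^n$) is a matrix $(a_{ij})$ over $k$ with $a_{ij}=0$ unless $\alpha_i\ge\beta_j$. It represents the graded degree-$0$ homomorphism $\bigoplus_j\Sigma^{\beta_j}R\to\bigoplus_i\Sigma^{\alpha_i}R^\vee$ sending the $j$-th canonical basis element to the element with $i$-th component $a_{ij}\in k=(\Sigma^{\alpha_i}R^\vee)_{\beta_j}$ when $\beta_j\le\alpha_i$ and $0$ otherwise. Here $F_M$ is identified with $\bigoplus_{(h,\nu)\in J}\Sigma^hR$ via the bases $(e_{(h,\nu)})_\nu$ of $M_h$, and $E_M$ with $\bigoplus_{(g,\mu)\in I}\Sigma^gR^\vee$ via the dual bases $(e^\ast_{(g,\mu)})_\mu$ of $\operatorname{Hom}_k(M_g,k)\cong M^\vee_{-g}$. *)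

theory Defs
  imports Complex_Main "HOL-Library.Poly_Mapping" "HOL-Library.Function_Algebras"
begin

section \<open>The polynomial ring and its grading group\<close>

text \<open>
  The variables are indexed by a finite type \<open>'n\<close>.  Exponents are the functions \<open>'n \<Rightarrow> nat\<close> and
  degrees the functions \<open>'n \<Rightarrow> int\<close>, both with their pointwise addition and order, and the
  polynomial ring over \<open>'k\<close> is the monoid algebra of the exponents.
\<close>

type_synonym 'n deg = "'n \<Rightarrow> int"
type_synonym ('n, 'k) mpoly = "('n \<Rightarrow> nat) \<Rightarrow>\<^sub>0 'k"

definition ideg :: "('n \<Rightarrow> nat) \<Rightarrow> 'n deg" where
  "ideg \<beta> = (\<lambda>i. int (\<beta> i))"

definition nexp :: "'n deg \<Rightarrow> ('n \<Rightarrow> nat)" where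
  "nexp a = (\<lambda>i. nat (a i))"

definition konst :: "'k::zero \<Rightarrow> ('n, 'k) mpoly" where
  "konst c = Poly_Mapping.single 0 c"

definition Xpow :: "('n \<Rightarrow> nat) \<Rightarrow> ('n, 'k::zero_neq_one) mpoly" where
  "Xpow \<beta> = Poly_Mapping.single \<beta> 1"


section \<open>Graded modules\<close>

text \<open>
  A graded module is given inside an ambient module, whose underlying set is a whole type: the
  ambient scalar multiplication \<open>gact\<close> and the homogeneous components \<open>gcomp\<close>.  The module
  itself is the internal direct sum \<open>gcar\<close> of the components; it may be smaller than the ambient one.
\<close>

record (overloaded) ('n, 'k::zero, 'm) gmod =
  gact :: "('n, 'k) mpoly \<Rightarrow> 'm \<Rightarrow> 'm"
  gcomp :: "'n deg \<Rightarrow> 'm set"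

definition gcar :: "('n, 'k::zero, 'm::comm_monoid_add) gmod \<Rightarrow> 'm set" where
  "gcar M = {\<Sum>a\<in>A. x a | A x. finite A \<and> (\<forall>a\<in>A. x a \<in> gcomp M a)}"

locale graded_module = module "gact M"
  for M :: "('n::finite, 'k::field, 'm::ab_group_add) gmod" +
  assumes comp_zero: "0 \<in> gcomp M a"
    and comp_add: "x \<in> gcomp M a \<Longrightarrow> y \<in> gcomp M a \<Longrightarrow> x + y \<in> gcomp M a"
    and comp_act: "x \<in> gcomp M a \<Longrightarrow> gact M (Poly_Mapping.single \<beta> c) x \<in> gcomp M (ideg \<beta> + a)"
    and comp_direct: "finite A \<Longrightarrow> (\<And>a. a \<in> A \<Longrightarrow> z a \<in> gcomp M a) \<Longrightarrow> (\<Sum>a\<in>A. z a) = 0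
      \<Longrightarrow> b \<in> A \<Longrightarrow> z b = 0"

definition kscale :: "('n, 'k::zero, 'm) gmod \<Rightarrow> 'k \<Rightarrow> 'm \<Rightarrow> 'm" where
  "kscale M c x = gact M (konst c) x"

definition gdim :: "('n, 'k::field, 'm::ab_group_add) gmod \<Rightarrow> 'n deg \<Rightarrow> nat" where
  "gdim M a = vector_space.dim (kscale M) (gcomp M a)"

definition gsupp :: "('n, 'k::zero, 'm::zero) gmod \<Rightarrow> 'n deg set" where
  "gsupp M = {a. gcomp M a \<noteq> {0}}"

definition finitely_supported :: "('n, 'k::zero, 'm::zero) gmod \<Rightarrow> bool" where
  "finitely_supported M \<longleftrightarrow> finite (gsupp M)"

definition finitely_generated :: "('n, 'k::field, 'm::ab_group_add) gmod \<Rightarrow> bool" where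
  "finitely_generated M \<longleftrightarrow> (\<exists>S. finite S \<and> S \<subseteq> gcar M \<and> module.span (gact M) S = gcar M)"

definition gshift :: "'n deg \<Rightarrow> ('n, 'k::zero, 'm) gmod \<Rightarrow> ('n, 'k, 'm) gmod" where
  "gshift g M = \<lparr>gact = gact M, gcomp = (\<lambda>a. gcomp M (a - g))\<rparr>"

definition is_ghom :: "('n, 'k::zero, 'm::ab_group_add) gmod \<Rightarrow> ('n, 'k, 'p::ab_group_add) gmod
    \<Rightarrow> ('m \<Rightarrow> 'p) \<Rightarrow> bool" where
  "is_ghom M N f \<longleftrightarrow>
     (\<forall>x\<in>gcar M. \<forall>y\<in>gcar M. f (x + y) = f x + f y) \<and>
     (\<forall>r. \<forall>x\<in>gcar M. f (gact M r x) = gact N r (f x)) \<and>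
     (\<forall>a. f ` gcomp M a \<subseteq> gcomp N a)"

definition is_giso :: "('n, 'k::zero, 'm::ab_group_add) gmod \<Rightarrow> ('n, 'k, 'p::ab_group_add) gmod
    \<Rightarrow> ('m \<Rightarrow> 'p) \<Rightarrow> bool" where
  "is_giso M N f \<longleftrightarrow> is_ghom M N f \<and> bij_betw f (gcar M) (gcar N)"

text \<open>
  Homomorphisms are total functions; so that they form a set in bijection with the mathematical
  homomorphisms, they are normalised to vanish outside \<open>gcar M\<close>.
\<close>

definition Hom0 :: "('n, 'k::zero, 'm::ab_group_add) gmod \<Rightarrow> ('n, 'k, 'p::ab_group_add) gmod
    \<Rightarrow> ('m \<Rightarrow> 'p) set" where
  "Hom0 M N = {f. is_ghom M N f \<and> (\<forall>x. x \<notin> gcar M \<longrightarrow> f x = 0)}"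

definition ghom :: "('n, 'k::zero, 'm::ab_group_add) gmod \<Rightarrow> ('n, 'k, 'p::ab_group_add) gmod
    \<Rightarrow> ('n, 'k, 'm \<Rightarrow> 'p) gmod" where
  "ghom M N = \<lparr>gact = (\<lambda>r f x. gact N r (f x)), gcomp = (\<lambda>a. Hom0 (gshift a M) N)\<rparr>"

text \<open>\<open>gprod\<close> is the degreewise product, whose elements are finite sums of homogeneous families.\<close>

definition gprod :: "('i \<Rightarrow> ('n, 'k::zero, 'm) gmod) \<Rightarrow> ('n, 'k, 'i \<Rightarrow> 'm) gmod" where
  "gprod N = \<lparr>gact = (\<lambda>r x i. gact (N i) r (x i)), gcomp = (\<lambda>a. {x. \<forall>i. x i \<in> gcomp (N i) a})\<rparr>"

definition gdsum :: "'i set \<Rightarrow> ('i \<Rightarrow> ('n, 'k::zero, 'm::zero) gmod) \<Rightarrow> ('n, 'k, 'i \<Rightarrow> 'm) gmod" where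
  "gdsum I N = \<lparr>gact = (\<lambda>r x i. gact (N i) r (x i)),
     gcomp = (\<lambda>a. {x. (\<forall>i\<in>I. x i \<in> gcomp (N i) a) \<and> (\<forall>i. i \<notin> I \<longrightarrow> x i = 0) \<and>
                     finite {i. x i \<noteq> 0}})\<rparr>"

text \<open>\<open>Hom\<^sub>k(V, N)\<close> for a \<open>k\<close>-subspace \<open>V\<close> of \<open>M\<close>, placed in degree 0.\<close>

definition homk :: "('n, 'k::zero, 'm::ab_group_add) gmod \<Rightarrow> 'm set \<Rightarrow> ('n, 'k, 'p::ab_group_add) gmod
    \<Rightarrow> ('n, 'k, 'm \<Rightarrow> 'p) gmod" where
  "homk M V N = \<lparr>gact = (\<lambda>r f v. gact N r (f v)),
     gcomp = (\<lambda>a. {f. (\<forall>v\<in>V. f v \<in> gcomp N a) \<and> (\<forall>v. v \<notin> V \<longrightarrow> f v = 0) \<and>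
                     (\<forall>v\<in>V. \<forall>w\<in>V. f (v + w) = f v + f w) \<and>
                     (\<forall>c. \<forall>v\<in>V. f (kscale M c v) = kscale N c (f v))})\<rparr>"


section \<open>The graded modules \<open>R\<close>, \<open>E(k)\<close> and Matlis duality\<close>

definition Rmod :: "('n, 'k::field, ('n, 'k) mpoly) gmod" where
  "Rmod = \<lparr>gact = (*), gcomp = (\<lambda>a. {r. \<forall>\<beta>\<in>Poly_Mapping.keys r. ideg \<beta> = a})\<rparr>"

text \<open>
  \<open>Ek\<close> is the module of inverse polynomials: \<open>Poly_Mapping.single \<gamma> 1\<close> is the monomial with exponent
  \<open>- \<gamma>\<close>, of degree \<open>- \<gamma>\<close>; the monomial with exponent \<open>\<beta>\<close> of the ring sends it to the one with
  exponent \<open>\<beta> - \<gamma>\<close> if \<open>\<beta> \<le> \<gamma>\<close> and to zero otherwise.  That this is the graded injective hull of \<open>k\<close>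
  is proved below (\<open>Ek_socle\<close>, \<open>Ek_essential\<close>, \<open>Ek_injective\<close>).
\<close>

definition inv_act :: "('n, 'k::field) mpoly \<Rightarrow> (('n \<Rightarrow> nat) \<Rightarrow>\<^sub>0 'k) \<Rightarrow> (('n \<Rightarrow> nat) \<Rightarrow>\<^sub>0 'k)" where
  "inv_act r x = (\<Sum>\<beta>\<in>Poly_Mapping.keys r. \<Sum>\<gamma>\<in>Poly_Mapping.keys x.
     if \<beta> \<le> \<gamma> then Poly_Mapping.single (\<gamma> - \<beta>) (Poly_Mapping.lookup r \<beta> * Poly_Mapping.lookup x \<gamma>) else 0)"

definition Ek :: "('n, 'k::field, ('n \<Rightarrow> nat) \<Rightarrow>\<^sub>0 'k) gmod" where
  "Ek = \<lparr>gact = inv_act, gcomp = (\<lambda>a. {x. \<forall>\<gamma>\<in>Poly_Mapping.keys x. - ideg \<gamma> = a})\<rparr>"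

definition mdual :: "('n, 'k::field, 'm::ab_group_add) gmod
    \<Rightarrow> ('n, 'k, 'm \<Rightarrow> (('n \<Rightarrow> nat) \<Rightarrow>\<^sub>0 'k)) gmod" where
  "mdual M = ghom M Ek"

abbreviation Rdual :: "('n, 'k::field, ('n, 'k) mpoly \<Rightarrow> (('n \<Rightarrow> nat) \<Rightarrow>\<^sub>0 'k)) gmod" where
  "Rdual \<equiv> mdual Rmod"

text \<open>
  The inverse of the isomorphism from the degree-\<open>a\<close> component of the Matlis dual of \<open>M\<close> to the
  \<open>k\<close>-dual of \<open>M\<^bsub>-a\<^esub>\<close>, which sends \<open>f\<close> to the restriction of \<open>f\<close> to \<open>M\<^bsub>-a\<^esub> \<rightarrow> E(k)\<^sub>0 = k\<close>.
\<close>

definition matlis_elem :: "('n, 'k::field, 'm::ab_group_add) gmod \<Rightarrow> 'n deg \<Rightarrow> ('m \<Rightarrow> 'k)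
    \<Rightarrow> ('m \<Rightarrow> (('n \<Rightarrow> nat) \<Rightarrow>\<^sub>0 'k))" where
  "matlis_elem M a l = (THE f. f \<in> gcomp (mdual M) a \<and> (\<forall>m\<in>gcomp M (- a). Poly_Mapping.lookup (f m) 0 = l m))"

text \<open>For \<open>a \<le> 0\<close>: the generator of the degree-\<open>a\<close> component of the Matlis dual of \<open>R\<close> given by the
  functional dual to \<open>X\<^sup>-\<^sup>a\<close>.\<close>

definition cogen :: "'n deg \<Rightarrow> ('n, 'k::field) mpoly \<Rightarrow> (('n \<Rightarrow> nat) \<Rightarrow>\<^sub>0 'k)" where
  "cogen a = matlis_elem Rmod a (\<lambda>r. Poly_Mapping.lookup r (nexp (- a)))"


section \<open>The associated presentation\<close>

text \<open>
  \<open>R \<otimes>\<^sub>k V\<close> for a \<open>k\<close>-subspace \<open>V\<close> of \<open>M\<close> is modelled as \<open>V[X\<^sub>1, \<dots>, X\<^sub>n]\<close>, with \<open>r \<otimes> v\<close> the polynomial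
  with coefficients \<open>r\<^sub>\<beta> v\<close>; the universal property is \<open>Rtensor_universal\<close> below.
\<close>

definition ptensor :: "('n, 'k::field, 'm::ab_group_add) gmod \<Rightarrow> ('n, 'k) mpoly \<Rightarrow> 'm
    \<Rightarrow> (('n \<Rightarrow> nat) \<Rightarrow>\<^sub>0 'm)" where
  "ptensor M r v = (\<Sum>\<beta>\<in>Poly_Mapping.keys r. Poly_Mapping.single \<beta> (kscale M (Poly_Mapping.lookup r \<beta>) v))"

definition tact :: "('n, 'k::field, 'm::ab_group_add) gmod \<Rightarrow> ('n, 'k) mpoly \<Rightarrow> (('n \<Rightarrow> nat) \<Rightarrow>\<^sub>0 'm) \<Rightarrow> (('n \<Rightarrow> nat) \<Rightarrow>\<^sub>0 'm)" where
  "tact M r t = (\<Sum>\<beta>\<in>Poly_Mapping.keys r. \<Sum>\<gamma>\<in>Poly_Mapping.keys t.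
        Poly_Mapping.single (\<beta> + \<gamma>) (kscale M (Poly_Mapping.lookup r \<beta>) (Poly_Mapping.lookup t \<gamma>)))"

definition Rtensor :: "('n, 'k::field, 'm::ab_group_add) gmod \<Rightarrow> 'm set
    \<Rightarrow> ('n, 'k, ('n \<Rightarrow> nat) \<Rightarrow>\<^sub>0 'm) gmod" where
  "Rtensor M V = \<lparr>gact = tact M,
     gcomp = (\<lambda>a. {t. (\<forall>\<gamma>. Poly_Mapping.lookup t \<gamma> \<in> V) \<and> (\<forall>\<gamma>\<in>Poly_Mapping.keys t. ideg \<gamma> = a)})\<rparr>"

definition FM :: "('n, 'k::field, 'm::ab_group_add) gmod
    \<Rightarrow> ('n, 'k, 'n deg \<Rightarrow> (('n \<Rightarrow> nat) \<Rightarrow>\<^sub>0 'm)) gmod" where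
  "FM M = gdsum UNIV (\<lambda>g. gshift g (Rtensor M (gcomp M g)))"

definition EM :: "('n, 'k::field, 'm::ab_group_add) gmod \<Rightarrow>
    ('n, 'k, 'n deg \<Rightarrow> ('m \<Rightarrow> (('n \<Rightarrow> nat) \<Rightarrow>\<^sub>0 'k)) \<Rightarrow> (('n, 'k) mpoly \<Rightarrow> (('n \<Rightarrow> nat) \<Rightarrow>\<^sub>0 'k))) gmod"
  where "EM M = gprod (\<lambda>h. homk (mdual M) (gcomp (mdual M) h) (gshift (- h) Rdual))"

text \<open>\<open>phi_hat\<close> is induced by \<open>r \<otimes> m \<mapsto> r m\<close>, see \<open>phi_hat_ptensor\<close> below.\<close>

definition phi_hat :: "('n, 'k::field, 'm::ab_group_add) gmod
    \<Rightarrow> ('n deg \<Rightarrow> (('n \<Rightarrow> nat) \<Rightarrow>\<^sub>0 'm)) \<Rightarrow> 'm" where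
  "phi_hat M t = (\<Sum>g | t g \<noteq> 0. \<Sum>\<gamma>\<in>Poly_Mapping.keys (t g). gact M (Xpow \<gamma>) (Poly_Mapping.lookup (t g) \<gamma>))"

definition u_map :: "('n, 'k::field, 'm::ab_group_add) gmod \<Rightarrow> 'm
    \<Rightarrow> ('m \<Rightarrow> (('n \<Rightarrow> nat) \<Rightarrow>\<^sub>0 'k)) \<Rightarrow> (('n \<Rightarrow> nat) \<Rightarrow>\<^sub>0 'k)" where
  "u_map M m = (\<lambda>f'. if f' \<in> gcar (mdual M) then f' m else 0)"

definition phi_check :: "('n, 'k::field, 'm::ab_group_add) gmod
    \<Rightarrow> (('m \<Rightarrow> (('n \<Rightarrow> nat) \<Rightarrow>\<^sub>0 'k)) \<Rightarrow> (('n \<Rightarrow> nat) \<Rightarrow>\<^sub>0 'k))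
    \<Rightarrow> 'n deg \<Rightarrow> ('m \<Rightarrow> (('n \<Rightarrow> nat) \<Rightarrow>\<^sub>0 'k)) \<Rightarrow> (('n, 'k) mpoly \<Rightarrow> (('n \<Rightarrow> nat) \<Rightarrow>\<^sub>0 'k))" where
  "phi_check M f'' = (\<lambda>h f'. if f' \<in> gcomp (mdual M) h then (\<lambda>r. gact Ek r (f'' f')) else 0)"

definition phi :: "('n, 'k::field, 'm::ab_group_add) gmod \<Rightarrow> ('n deg \<Rightarrow> (('n \<Rightarrow> nat) \<Rightarrow>\<^sub>0 'm))
    \<Rightarrow> 'n deg \<Rightarrow> ('m \<Rightarrow> (('n \<Rightarrow> nat) \<Rightarrow>\<^sub>0 'k)) \<Rightarrow> (('n, 'k) mpoly \<Rightarrow> (('n \<Rightarrow> nat) \<Rightarrow>\<^sub>0 'k))" where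
  "phi M = phi_check M \<circ> u_map M \<circ> phi_hat M"


section \<open>Monomial matrices and the identifications given by bases\<close>

definition monomial_matrix ::
    "'i set \<Rightarrow> 'j set \<Rightarrow> ('i \<Rightarrow> 'n deg) \<Rightarrow> ('j \<Rightarrow> 'n deg) \<Rightarrow> ('i \<Rightarrow> 'j \<Rightarrow> 'k::field) \<Rightarrow> bool" where
  "monomial_matrix I J \<alpha> \<beta> A \<longleftrightarrow>
     finite I \<and> finite J \<and> (\<forall>i\<in>I. \<forall>j\<in>J. \<not> \<beta> j \<le> \<alpha> i \<longrightarrow> A i j = 0)"

definition free_mod :: "'j set \<Rightarrow> ('j \<Rightarrow> 'n deg) \<Rightarrow> ('n, 'k::field, 'j \<Rightarrow> ('n, 'k) mpoly) gmod" where
  "free_mod J \<beta> = gdsum J (\<lambda>j. gshift (\<beta> j) Rmod)"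

definition cofree_mod :: "'i set \<Rightarrow> ('i \<Rightarrow> 'n deg)
    \<Rightarrow> ('n, 'k::field, 'i \<Rightarrow> ('n, 'k) mpoly \<Rightarrow> (('n \<Rightarrow> nat) \<Rightarrow>\<^sub>0 'k)) gmod" where
  "cofree_mod I \<alpha> = gdsum I (\<lambda>i. gshift (\<alpha> i) Rdual)"

definition represents ::
    "'i set \<Rightarrow> 'j set \<Rightarrow> ('i \<Rightarrow> 'n deg) \<Rightarrow> ('j \<Rightarrow> 'n deg) \<Rightarrow> ('i \<Rightarrow> 'j \<Rightarrow> 'k::field)
     \<Rightarrow> (('j \<Rightarrow> ('n, 'k) mpoly) \<Rightarrow> ('i \<Rightarrow> ('n, 'k) mpoly \<Rightarrow> (('n \<Rightarrow> nat) \<Rightarrow>\<^sub>0 'k))) \<Rightarrow> bool" where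
  "represents I J \<alpha> \<beta> A f \<longleftrightarrow>
     is_ghom (free_mod J \<beta>) (cofree_mod I \<alpha>) f \<and>
     (\<forall>j\<in>J. f (\<lambda>j'. if j' = j then 1 else 0) =
        (\<lambda>i. if i \<in> I \<and> \<beta> j \<le> \<alpha> i then kscale Rdual (A i j) (cogen (\<beta> j - \<alpha> i)) else 0))"

definition basis_of_comp :: "('n, 'k::field, 'm::ab_group_add) gmod \<Rightarrow> ('n deg \<times> nat \<Rightarrow> 'm)
    \<Rightarrow> 'n deg \<Rightarrow> bool" where
  "basis_of_comp M e g \<longleftrightarrow>
     inj_on e ({g} \<times> {1..gdim M g}) \<and>
     \<not> module.dependent (kscale M) (e ` ({g} \<times> {1..gdim M g})) \<and>
     module.span (kscale M) (e ` ({g} \<times> {1..gdim M g})) = gcomp M g"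

definition dual_basis :: "('n, 'k::field, 'm::ab_group_add) gmod \<Rightarrow> ('n deg \<times> nat \<Rightarrow> 'm)
    \<Rightarrow> 'n deg \<times> nat \<Rightarrow> ('m \<Rightarrow> (('n \<Rightarrow> nat) \<Rightarrow>\<^sub>0 'k))" where
  "dual_basis M e = (\<lambda>(g, \<mu>). matlis_elem M (- g)
     (\<lambda>m. module.representation (kscale M) (e ` ({g} \<times> {1..gdim M g})) m (e (g, \<mu>))))"

text \<open>
  The identification of \<open>\<Oplus>\<^bsub>(h,\<nu>)\<^esub> \<Sigma>\<^sup>hR\<close> with \<open>FM M\<close> sends the basis element with index \<open>(h,\<nu>)\<close> to
  \<open>1 \<otimes> e (h,\<nu>)\<close>; that of \<open>EM M\<close> with \<open>\<Oplus>\<^bsub>(g,\<mu>)\<^esub> \<Sigma>\<^sup>gR\<^sup>\<or>\<close> evaluates the component of a family in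
  \<open>Hom\<^sub>k(M\<^sup>\<or>\<^bsub>-g\<^esub>, \<Sigma>\<^sup>gR\<^sup>\<or>)\<close> at the members of the dual basis.
\<close>

definition F_ident :: "('n, 'k::field, 'm::ab_group_add) gmod \<Rightarrow> ('n deg \<times> nat \<Rightarrow> 'm)
    \<Rightarrow> ('n deg \<times> nat \<Rightarrow> ('n, 'k) mpoly) \<Rightarrow> ('n deg \<Rightarrow> (('n \<Rightarrow> nat) \<Rightarrow>\<^sub>0 'm))" where
  "F_ident M e x = (\<lambda>h. \<Sum>\<nu> = 1..gdim M h. ptensor M (x (h, \<nu>)) (e (h, \<nu>)))"

definition E_ident :: "('n, 'k::field, 'm::ab_group_add) gmod \<Rightarrow> ('n deg \<times> nat \<Rightarrow> 'm)
    \<Rightarrow> ('n deg \<Rightarrow> ('m \<Rightarrow> (('n \<Rightarrow> nat) \<Rightarrow>\<^sub>0 'k)) \<Rightarrow> (('n, 'k) mpoly \<Rightarrow> (('n \<Rightarrow> nat) \<Rightarrow>\<^sub>0 'k)))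
    \<Rightarrow> ('n deg \<times> nat \<Rightarrow> ('n, 'k) mpoly \<Rightarrow> (('n \<Rightarrow> nat) \<Rightarrow>\<^sub>0 'k))" where
  "E_ident M e \<theta> = (\<lambda>(g, \<mu>). if g \<in> gsupp M \<and> \<mu> \<in> {1..gdim M g}
     then \<theta> (- g) (dual_basis M e (g, \<mu>)) else 0)"


section \<open>Justification of the models\<close>

lemma pm_sum_singles: "(\<Sum>k\<in>Poly_Mapping.keys p. Poly_Mapping.single k (Poly_Mapping.lookup p k)) = p"
proof (rule poly_mapping_eqI)
  fix k
  show "Poly_Mapping.lookup (\<Sum>k\<in>Poly_Mapping.keys p. Poly_Mapping.single k (Poly_Mapping.lookup p k)) k
     = Poly_Mapping.lookup p k"
    by (cases "k \<in> Poly_Mapping.keys p")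
       (auto simp: lookup_sum lookup_single when_def in_keys_iff sum.delta' sum.neutral)
qed

lemma pm_induct [case_names zero single add]:
  assumes "P 0" "\<And>k c. P (Poly_Mapping.single k c)" "\<And>p q. P p \<Longrightarrow> P q \<Longrightarrow> P (p + q)"
  shows "P (p :: 'a \<Rightarrow>\<^sub>0 'b::comm_monoid_add)"
proof -
  have "finite K \<Longrightarrow> P (\<Sum>k\<in>K. Poly_Mapping.single k (Poly_Mapping.lookup p k))" for K
    by (induction K rule: finite_induct) (use assms in auto)
  from this[of "Poly_Mapping.keys p"] show ?thesis by (simp add: pm_sum_singles)
qed

lemma lookup_inv_act:
  fixes r :: "('n, 'k::field) mpoly"
  shows "Poly_Mapping.lookup (inv_act r x) \<gamma> =
     (\<Sum>\<beta>\<in>Poly_Mapping.keys r. Poly_Mapping.lookup r \<beta> * Poly_Mapping.lookup x (\<beta> + \<gamma>))"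
proof -
  have *: "(\<Sum>\<delta>\<in>Poly_Mapping.keys x. Poly_Mapping.lookup (if \<beta> \<le> \<delta> then Poly_Mapping.single (\<delta> - \<beta>) (c * Poly_Mapping.lookup x \<delta>) else 0) \<gamma>)
     = c * Poly_Mapping.lookup x (\<beta> + \<gamma>)" for c :: 'k and \<beta>
  proof -
    have eq: "(\<beta> \<le> \<delta> \<and> \<delta> - \<beta> = \<gamma>) \<longleftrightarrow> \<delta> = \<beta> + \<gamma>" for \<delta> :: "'n \<Rightarrow> nat"
    proof
      assume a: "\<beta> \<le> \<delta> \<and> \<delta> - \<beta> = \<gamma>"
      show "\<delta> = \<beta> + \<gamma>"
      proof
        fix i
        from a have "\<beta> i \<le> \<delta> i" "\<gamma> i = \<delta> i - \<beta> i" by (auto simp: le_fun_def)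
        then show "\<delta> i = (\<beta> + \<gamma>) i" by simp
      qed
    qed (auto simp: le_fun_def fun_eq_iff)
    have "(\<Sum>\<delta>\<in>Poly_Mapping.keys x. Poly_Mapping.lookup (if \<beta> \<le> \<delta> then Poly_Mapping.single (\<delta> - \<beta>) (c * Poly_Mapping.lookup x \<delta>) else 0) \<gamma>)
       = (\<Sum>\<delta>\<in>Poly_Mapping.keys x. if \<delta> = \<beta> + \<gamma> then c * Poly_Mapping.lookup x \<delta> else 0)"
      by (rule sum.cong) (auto simp: lookup_single when_def simp flip: eq)
    also have "\<dots> = c * Poly_Mapping.lookup x (\<beta> + \<gamma>)"
      by (auto simp: in_keys_iff)
    finally show ?thesis .
  qed
  show ?thesis
    unfolding inv_act_def by (simp only: lookup_sum *)
qed

lemma lookup_inv_act':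
  assumes "finite K" "Poly_Mapping.keys r \<subseteq> K"
  shows "Poly_Mapping.lookup (inv_act r x) \<gamma> =
     (\<Sum>\<beta>\<in>K. Poly_Mapping.lookup r \<beta> * Poly_Mapping.lookup x (\<beta> + \<gamma>))"
  unfolding lookup_inv_act
  by (rule sum.mono_neutral_left) (use assms in \<open>auto simp: in_keys_iff\<close>)

lemma lookup_inv_act_single:
  "Poly_Mapping.lookup (inv_act (Poly_Mapping.single \<beta> c) x) \<gamma> = c * Poly_Mapping.lookup x (\<beta> + \<gamma>)"
  by (subst lookup_inv_act'[of "{\<beta>}"]) auto

lemma inv_act_add_left: "inv_act (r + s) x = inv_act r x + inv_act s x"
proof (rule poly_mapping_eqI)
  fix \<gamma>
  let ?K = "Poly_Mapping.keys r \<union> Poly_Mapping.keys s"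
  have "Poly_Mapping.keys (r + s) \<subseteq> ?K" by (rule keys_add)
  then show "Poly_Mapping.lookup (inv_act (r + s) x) \<gamma> = Poly_Mapping.lookup (inv_act r x + inv_act s x) \<gamma>"
    by (simp add: lookup_inv_act'[of ?K] lookup_add sum.distrib algebra_simps)
qed

lemma inv_act_add_right: "inv_act r (x + y) = inv_act r x + inv_act r y"
  by (rule poly_mapping_eqI) (simp add: lookup_inv_act lookup_add sum.distrib algebra_simps)

lemma inv_act_0 [simp]: "inv_act 0 x = 0"
  by (simp add: inv_act_def)

lemma inv_act_mult: "inv_act r (inv_act s x) = inv_act (r * s) x"
proof (induction r rule: pm_induct)
  case (single \<beta> c)
  show ?case
  proof (induction s rule: pm_induct)
    case (single \<gamma> d)
    show ?case
      by (rule poly_mapping_eqI) (simp add: mult_single lookup_inv_act_single algebra_simps)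
  next
    case zero then show ?case by (simp add: inv_act_def)
  qed (simp_all add: inv_act_add_left inv_act_add_right algebra_simps)
qed (simp_all add: inv_act_add_left algebra_simps)

lemma module_inv_act: "module (inv_act :: ('n, 'k::field) mpoly \<Rightarrow> _)"
proof
  fix x :: "('n \<Rightarrow> nat) \<Rightarrow>\<^sub>0 'k"
  show "inv_act 1 x = x"
    by (rule poly_mapping_eqI) (simp add: lookup_inv_act_single flip: single_one)
qed (simp_all add: inv_act_add_left inv_act_add_right inv_act_mult)

lemma graded_module_Ek: "graded_module (Ek :: ('n::finite, 'k::field, _) gmod)"
proof -
  interpret module "gact Ek :: ('n, 'k) mpoly \<Rightarrow> _" by (simp add: Ek_def module_inv_act)
  show ?thesis
  proof
    fix a :: "'n deg" and x y
    show "0 \<in> gcomp (Ek :: ('n, 'k, _) gmod) a" by (simp add: Ek_def)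
    show "x \<in> gcomp (Ek :: ('n, 'k, _) gmod) a \<Longrightarrow> y \<in> gcomp Ek a \<Longrightarrow> x + y \<in> gcomp Ek a"
      using keys_add[of x y] by (auto simp: Ek_def)
  next
    fix a :: "'n deg" and x :: "('n \<Rightarrow> nat) \<Rightarrow>\<^sub>0 'k" and \<beta> c
    assume x: "x \<in> gcomp Ek a"
    show "gact Ek (Poly_Mapping.single \<beta> c) x \<in> gcomp Ek (ideg \<beta> + a)"
    proof -
      have "- ideg \<gamma> = ideg \<beta> + a" if "Poly_Mapping.lookup x (\<beta> + \<gamma>) \<noteq> 0" for \<gamma>
      proof -
        have "- ideg (\<beta> + \<gamma>) = a" using x that by (auto simp: Ek_def in_keys_iff)
        then have "(- ideg (\<beta> + \<gamma>)) i = a i" for i by simp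
        then have "- int (\<gamma> i) = int (\<beta> i) + a i" for i
          by (simp add: ideg_def) (metis add.inverse_inverse diff_add_cancel minus_add_cancel minus_diff_eq add.commute uminus_add_conv_diff)
        then show ?thesis by (auto simp: ideg_def fun_eq_iff)
      qed
      then show ?thesis
        by (auto simp: Ek_def in_keys_iff lookup_inv_act_single)
    qed
  next
    fix A :: "'n deg set" and z b
    assume A: "finite A" and z: "\<And>a. a \<in> A \<Longrightarrow> z a \<in> gcomp (Ek :: ('n, 'k, _) gmod) a"
      and s: "sum z A = 0" and b: "b \<in> A"
    show "z b = 0"
    proof (rule poly_mapping_eqI)
      fix \<gamma>
      show "Poly_Mapping.lookup (z b) \<gamma> = Poly_Mapping.lookup 0 \<gamma>"
      proof (cases "- ideg \<gamma> = b")
        case False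
        then show ?thesis using z[OF b] by (auto simp: Ek_def in_keys_iff)
      next
        case True
        have "0 = (\<Sum>a\<in>A. Poly_Mapping.lookup (z a) \<gamma>)" using s by (simp flip: lookup_sum)
        also have "\<dots> = (\<Sum>a\<in>{b}. Poly_Mapping.lookup (z a) \<gamma>)"
          by (rule sum.mono_neutral_right) (use A b z True in \<open>auto simp: Ek_def in_keys_iff\<close>)
        finally show ?thesis by simp
      qed
    qed
  qed
qed

context graded_module
begin

lemma comp_scale: "x \<in> gcomp M a \<Longrightarrow> kscale M c x \<in> gcomp M a"
  using comp_act[of x a 0 c] by (simp add: kscale_def konst_def ideg_def flip: zero_fun_def)

lemma comp_neg: "x \<in> gcomp M a \<Longrightarrow> - x \<in> gcomp M a"
proof -
  assume "x \<in> gcomp M a"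
  moreover have "kscale M (-1) x = - x"
    by (simp add: kscale_def konst_def single_uminus)
  ultimately show ?thesis using comp_scale[of x a "-1"] by simp
qed

lemma comp_sum: "(\<And>i. i \<in> I \<Longrightarrow> z i \<in> gcomp M a) \<Longrightarrow> sum z I \<in> gcomp M a"
  by (induction I rule: infinite_finite_induct) (auto intro: comp_zero comp_add)

definition isdec :: "'m \<Rightarrow> ('n deg \<Rightarrow> 'm) \<Rightarrow> bool" where
  "isdec x z \<longleftrightarrow> (\<forall>a. z a \<in> gcomp M a) \<and> finite {a. z a \<noteq> 0} \<and> x = (\<Sum>a | z a \<noteq> 0. z a)"

lemma isdec_sum: "isdec x z \<Longrightarrow> finite A \<Longrightarrow> {a. z a \<noteq> 0} \<subseteq> A \<Longrightarrow> x = (\<Sum>a\<in>A. z a)"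
  unfolding isdec_def by (auto intro: sum.mono_neutral_left)

lemma isdecI: "(\<And>a. z a \<in> gcomp M a) \<Longrightarrow> finite A \<Longrightarrow> {a. z a \<noteq> 0} \<subseteq> A \<Longrightarrow> x = (\<Sum>a\<in>A. z a) \<Longrightarrow> isdec x z"
  unfolding isdec_def by (auto intro: sum.mono_neutral_right finite_subset)

lemma isdec_add: assumes "isdec x z" "isdec y w" shows "isdec (x + y) (\<lambda>a. z a + w a)"
proof (rule isdecI[where A = "{a. z a \<noteq> 0} \<union> {a. w a \<noteq> 0}"])
  let ?A = "{a. z a \<noteq> 0} \<union> {a. w a \<noteq> 0}"
  show fin: "finite ?A" using assms by (auto simp: isdec_def)
  show "x + y = (\<Sum>a\<in>?A. z a + w a)"
    using isdec_sum[OF assms(1) fin] isdec_sum[OF assms(2) fin] by (simp add: sum.distrib)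
qed (use assms in \<open>auto simp: isdec_def intro: comp_add\<close>)

lemma isdec_single: "x \<in> gcomp M a \<Longrightarrow> isdec x (\<lambda>b. if b = a then x else 0)"
  by (rule isdecI[where A = "{a}"]) (auto intro: comp_zero)

lemma isdec_0: "isdec 0 (\<lambda>b. 0)"
  by (rule isdecI[where A = "{}"]) (auto intro: comp_zero)

lemma isdec_unique: assumes "isdec x z" "isdec x w" shows "z = w"
proof
  fix b
  let ?A = "insert b ({a. z a \<noteq> 0} \<union> {a. w a \<noteq> 0})"
  have fin: "finite ?A" using assms by (auto simp: isdec_def)
  have s: "(\<Sum>a\<in>?A. z a - w a) = 0"
    using isdec_sum[OF assms(1) fin] isdec_sum[OF assms(2) fin] by (auto simp: sum_subtractf)
  have mem: "z a - w a \<in> gcomp M a" for a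
    using assms comp_add[OF _ comp_neg, of "z a" a "w a"] by (auto simp: isdec_def)
  have "z b - w b = 0"
    by (rule comp_direct[OF fin mem s]) simp
  then show "z b = w b" by simp
qed

lemma isdec_act: assumes "isdec x z"
  shows "isdec (gact M (Poly_Mapping.single \<beta> c) x) (\<lambda>a. gact M (Poly_Mapping.single \<beta> c) (z (a - ideg \<beta>)))"
proof (rule isdecI[where A = "(\<lambda>a. ideg \<beta> + a) ` {a. z a \<noteq> 0}"])
  fix a
  show "gact M (Poly_Mapping.single \<beta> c) (z (a - ideg \<beta>)) \<in> gcomp M a"
    using comp_act[of "z (a - ideg \<beta>)" "a - ideg \<beta>" \<beta> c] assms by (simp add: isdec_def)
next
  show "{a. gact M (Poly_Mapping.single \<beta> c) (z (a - ideg \<beta>)) \<noteq> 0} \<subseteq> (\<lambda>a. ideg \<beta> + a) ` {a. z a \<noteq> 0}"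
  proof
    fix a assume "a \<in> {a. gact M (Poly_Mapping.single \<beta> c) (z (a - ideg \<beta>)) \<noteq> 0}"
    then have "z (a - ideg \<beta>) \<noteq> 0" by auto
    then show "a \<in> (\<lambda>a. ideg \<beta> + a) ` {a. z a \<noteq> 0}"
      by (intro image_eqI[of _ _ "a - ideg \<beta>"]) auto
  qed
  have x: "x = (\<Sum>a | z a \<noteq> 0. z a)" using assms by (simp add: isdec_def)
  have inj: "inj_on (\<lambda>a. ideg \<beta> + a) X" for X by (auto simp: inj_on_def)
  show "gact M (Poly_Mapping.single \<beta> c) x = (\<Sum>a\<in>(+) (ideg \<beta>) ` {a. z a \<noteq> 0}. gact M (Poly_Mapping.single \<beta> c) (z (a - ideg \<beta>)))"
    by (subst x) (simp add: scale_sum_right sum.reindex[OF inj])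
qed (use assms in \<open>auto simp: isdec_def\<close>)

lemma gcar_iff: "x \<in> gcar M \<longleftrightarrow> (\<exists>z. isdec x z)"
proof
  assume "x \<in> gcar M"
  then obtain A z where A: "finite A" "\<forall>a\<in>A. z a \<in> gcomp M a" "x = sum z A" by (auto simp: gcar_def)
  have "isdec x (\<lambda>a. if a \<in> A then z a else 0)"
    by (rule isdecI[where A = A]) (use A in \<open>auto intro: comp_zero\<close>)
  then show "\<exists>z. isdec x z" by blast
next
  assume "\<exists>z. isdec x z"
  then show "x \<in> gcar M" by (auto simp: gcar_def isdec_def)
qed

definition hc :: "'m \<Rightarrow> 'n deg \<Rightarrow> 'm" where "hc x = (SOME z. isdec x z)"

lemma hc: "x \<in> gcar M \<Longrightarrow> isdec x (hc x)"
  unfolding hc_def gcar_iff by (erule someI_ex)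

lemma hc_eq: "isdec x z \<Longrightarrow> hc x = z"
  using hc[of x] isdec_unique by (auto simp: gcar_iff)

lemma gcar_comp: "x \<in> gcomp M a \<Longrightarrow> x \<in> gcar M"
  using isdec_single gcar_iff by blast

lemma gcar_0: "0 \<in> gcar M" using isdec_0 gcar_iff by blast

lemma gcar_add: "x \<in> gcar M \<Longrightarrow> y \<in> gcar M \<Longrightarrow> x + y \<in> gcar M"
  using isdec_add gcar_iff by metis

lemma gcar_sum: "(\<And>i. i \<in> I \<Longrightarrow> z i \<in> gcar M) \<Longrightarrow> sum z I \<in> gcar M"
  by (induction I rule: infinite_finite_induct) (auto intro: gcar_0 gcar_add)

lemma gcar_act: "x \<in> gcar M \<Longrightarrow> gact M r x \<in> gcar M"
proof (induction r rule: pm_induct)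
  case (single k c) then show ?case using isdec_act gcar_iff by metis
qed (auto simp: gcar_0 gcar_add scale_left_distrib)

lemma gcar_induct [consumes 1, case_names comp add]:
  assumes "x \<in> gcar M" "\<And>a x. x \<in> gcomp M a \<Longrightarrow> P x"
    "\<And>x y. x \<in> gcar M \<Longrightarrow> y \<in> gcar M \<Longrightarrow> P x \<Longrightarrow> P y \<Longrightarrow> P (x + y)"
  shows "P x"
proof -
  have "finite A \<Longrightarrow> (\<And>a. a \<in> A \<Longrightarrow> z a \<in> gcomp M a) \<Longrightarrow> P (sum z A) \<and> sum z A \<in> gcar M" for A z
    by (induction A rule: finite_induct) (auto intro: assms comp_zero gcar_0 gcar_comp gcar_add)
  with assms(1) show ?thesis by (auto simp: gcar_def)
qed

lemma hc_add: "x \<in> gcar M \<Longrightarrow> y \<in> gcar M \<Longrightarrow> hc (x + y) a = hc x a + hc y a"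
  using hc_eq[OF isdec_add[OF hc hc]] by simp

lemma hc_comp: "x \<in> gcomp M a \<Longrightarrow> hc x b = (if b = a then x else 0)"
  using hc_eq[OF isdec_single] by simp

lemma hc_act: "x \<in> gcar M \<Longrightarrow> hc (gact M (Poly_Mapping.single \<beta> c) x) a = gact M (Poly_Mapping.single \<beta> c) (hc x (a - ideg \<beta>))"
  using hc_eq[OF isdec_act[OF hc]] by simp

lemma hc_mem: "x \<in> gcar M \<Longrightarrow> hc x a \<in> gcomp M a"
  using hc by (auto simp: isdec_def)

lemma hc_fin: "x \<in> gcar M \<Longrightarrow> finite {a. hc x a \<noteq> 0}"
  using hc by (auto simp: isdec_def)

end

lemma gcar_gshift [simp]: "gcar (gshift g M) = gcar M"
proof -
  have "x \<in> gcar (gshift g M)" if "x \<in> gcar M" for x and g and M :: "('n, 'k::zero, 'm::comm_monoid_add) gmod"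
  proof -
    from that obtain A z where A: "finite A" "\<forall>a\<in>A. z a \<in> gcomp M a" "x = sum z A" by (auto simp: gcar_def)
    have inj: "inj_on (\<lambda>a. a + g) A" by (auto simp: inj_on_def)
    have "x = (\<Sum>a\<in>(\<lambda>a. a + g) ` A. z (a - g))" using A by (simp add: sum.reindex[OF inj])
    then show ?thesis using A by (auto simp: gcar_def gshift_def intro!: exI[of _ "(\<lambda>a. a + g) ` A"] exI[of _ "\<lambda>a. z (a - g)"])
  qed
  moreover have "gshift (- g) (gshift g M) = M" by (simp add: gshift_def)
  ultimately show ?thesis by (metis subset_antisym subsetI)
qed

lemma graded_module_gshift: assumes "graded_module M" shows "graded_module (gshift g M)"
proof -
  interpret graded_module M by fact
  interpret a: module "gact (gshift g M)" using module_axioms by (simp add: gshift_def)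
  show ?thesis
  proof
    fix x a \<beta> c assume "x \<in> gcomp (gshift g M) a"
    then show "gact (gshift g M) (Poly_Mapping.single \<beta> c) x \<in> gcomp (gshift g M) (ideg \<beta> + a)"
      using comp_act[of x "a - g" \<beta> c] by (simp add: gshift_def algebra_simps)
  next
    fix A z b assume A: "finite A" "\<And>a. a \<in> A \<Longrightarrow> z a \<in> gcomp (gshift g M) a" "sum z A = 0" "b \<in> A"
    have inj: "inj_on (\<lambda>a. a - g) A" by (auto simp: inj_on_def)
    have "z (b - g + g) = 0"
      by (rule comp_direct[of "(\<lambda>a. a - g) ` A" "\<lambda>a. z (a + g)"])
         (use A in \<open>auto simp: gshift_def sum.reindex[OF inj]\<close>)
    then show "z b = 0" by simp
  qed (auto simp: gshift_def comp_zero comp_add)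
qed


lemma ideg_inj: "ideg \<beta> = ideg \<gamma> \<longleftrightarrow> \<beta> = \<gamma>"
  by (auto simp: ideg_def fun_eq_iff)

lemma ideg_add: "ideg (\<beta> + \<gamma>) = ideg \<beta> + ideg \<gamma>"
  by (auto simp: ideg_def)

lemma ideg_0 [simp]: "ideg 0 = 0"
  by (auto simp: ideg_def)

lemma is_ghomI:
  assumes "graded_module M" "module (gact N)"
    and add: "\<And>x y. x \<in> gcar M \<Longrightarrow> y \<in> gcar M \<Longrightarrow> f (x + y) = f x + f y"
    and act: "\<And>\<beta> c x. x \<in> gcar M \<Longrightarrow> f (gact M (Poly_Mapping.single \<beta> c) x) = gact N (Poly_Mapping.single \<beta> c) (f x)"
    and comp: "\<And>a x. x \<in> gcomp M a \<Longrightarrow> f x \<in> gcomp N a"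
  shows "is_ghom M N f"
proof -
  interpret graded_module M by fact
  interpret N: module "gact N" by fact
  have f0: "f 0 = 0" using add[OF gcar_0 gcar_0] by simp
  have "f (gact M r x) = gact N r (f x)" if "x \<in> gcar M" for r x
    using that
  proof (induction r rule: pm_induct)
    case (add p q)
    then show ?case
      by (simp add: scale_left_distrib N.scale_left_distrib gcar_act assms(3))
  qed (simp_all add: f0 act)
  then show ?thesis using add comp by (auto simp: is_ghom_def)
qed

lemma mdual_comp_iff: "f \<in> gcomp (mdual M) a \<longleftrightarrow> is_ghom (gshift a M) Ek f \<and> (\<forall>x. x \<notin> gcar M \<longrightarrow> f x = 0)"
  by (simp add: mdual_def ghom_def Hom0_def)

text \<open>
  \<open>mdual_eqI\<close> and \<open>mdual_exists\<close> say that the degree-\<open>a\<close> component of the Matlis dual of \<open>M\<close> is the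
  \<open>k\<close>-dual of \<open>M\<^bsub>-a\<^esub>\<close>, by the map inverted in \<open>matlis_elem\<close>.
\<close>

definition klin :: "('n, 'k::field, 'm::ab_group_add) gmod \<Rightarrow> 'm set \<Rightarrow> ('m \<Rightarrow> 'k) \<Rightarrow> bool" where
  "klin M V l \<longleftrightarrow> (\<forall>x\<in>V. \<forall>y\<in>V. l (x + y) = l x + l y) \<and> (\<forall>c. \<forall>x\<in>V. l (kscale M c x) = c * l x)"

lemma Ek_comp_lookup: "x \<in> gcomp Ek a \<Longrightarrow> a \<noteq> - ideg \<gamma> \<Longrightarrow> Poly_Mapping.lookup x \<gamma> = 0"
  by (auto simp: Ek_def in_keys_iff)

lemma mdual_mult:
  assumes "f \<in> gcomp (mdual M) a" "x \<in> gcar M"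
  shows "Poly_Mapping.lookup (f x) \<gamma> = Poly_Mapping.lookup (f (gact M (Xpow \<gamma>) x)) 0"
proof -
  have "f (gact M (Xpow \<gamma>) x) = inv_act (Xpow \<gamma>) (f x)"
    using assms by (auto simp: mdual_comp_iff is_ghom_def) (simp add: gshift_def Ek_def)
  then show ?thesis by (simp add: Xpow_def lookup_inv_act_single)
qed

lemma mdual_comp_deg:
  assumes "f \<in> gcomp (mdual M) a" "x \<in> gcomp M b"
  shows "f x \<in> gcomp Ek (a + b)"
proof -
  have "x \<in> gcomp (gshift a M) (a + b)" using assms by (simp add: gshift_def)
  then show ?thesis using assms(1) by (auto simp: mdual_comp_iff is_ghom_def image_subset_iff)
qed

lemma mdual_eqI:
  assumes "graded_module M" "f \<in> gcomp (mdual M) a" "g \<in> gcomp (mdual M) a"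
    and eq: "\<And>m. m \<in> gcomp M (- a) \<Longrightarrow> Poly_Mapping.lookup (f m) 0 = Poly_Mapping.lookup (g m) 0"
  shows "f = g"
proof
  fix x
  interpret graded_module M by fact
  show "f x = g x"
  proof (cases "x \<in> gcar M")
    case True
    then show ?thesis
    proof (induction x rule: gcar_induct)
      case (comp b x)
      show ?case
      proof (rule poly_mapping_eqI)
        fix \<gamma>
        show "Poly_Mapping.lookup (f x) \<gamma> = Poly_Mapping.lookup (g x) \<gamma>"
        proof (cases "a + b = - ideg \<gamma>")
          case True
          then have "ideg \<gamma> + b = - a"
            by (metis add.commute add.left_commute add_right_cancel neg_eq_iff_add_eq_0 minus_add_cancel)
          then have "gact M (Xpow \<gamma>) x \<in> gcomp M (- a)"
            using comp_act[OF comp, of \<gamma> 1] by (simp add: Xpow_def)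
          then show ?thesis using mdual_mult[OF _ gcar_comp[OF comp]] assms eq by metis
        next
          case False
          then show ?thesis
            using Ek_comp_lookup mdual_comp_deg comp assms(2,3) by metis
        qed
      qed
    next
      case (add x y)
      then show ?case using assms(2,3) by (simp add: mdual_comp_iff is_ghom_def)
    qed
  qed (use assms in \<open>auto simp: mdual_comp_iff\<close>)
qed

lemma mdual_exists:
  assumes "graded_module M" and l: "klin M (gcomp M (- a)) l"
  shows "\<exists>f. f \<in> gcomp (mdual M) a \<and> (\<forall>m\<in>gcomp M (- a). Poly_Mapping.lookup (f m) 0 = l m)"
proof -
  interpret graded_module M by fact
  interpret S: graded_module "gshift a M" using assms(1) by (rule graded_module_gshift)
  have l0: "l 0 = 0" using l comp_zero unfolding klin_def by (metis add.right_neutral add_left_cancel)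
  define F where "F x \<gamma> = l (gact M (Xpow \<gamma>) (hc x (- a - ideg \<gamma>)))" for x \<gamma>
  define f where "f x = (if x \<in> gcar M then Abs_poly_mapping (F x) else 0)" for x
  have mem: "gact M (Xpow \<gamma>) (hc x (- a - ideg \<gamma>)) \<in> gcomp M (- a)" if "x \<in> gcar M" for x \<gamma>
    using comp_act[OF hc_mem[OF that, of "- a - ideg \<gamma>"], of \<gamma> 1] by (simp add: Xpow_def)
  have fin: "finite {\<gamma>. F x \<gamma> \<noteq> 0}" if "x \<in> gcar M" for x
  proof -
    have "inj (\<lambda>\<gamma>. - a - ideg \<gamma> :: 'a deg)" by (auto simp: inj_on_def ideg_inj)
    with hc_fin[OF that] have "finite ((\<lambda>\<gamma>. - a - ideg \<gamma>) -` {b. hc x b \<noteq> 0})" by (rule finite_vimageI)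
    moreover have "{\<gamma>. F x \<gamma> \<noteq> 0} \<subseteq> (\<lambda>\<gamma>. - a - ideg \<gamma>) -` {b. hc x b \<noteq> 0}"
      by (auto simp: F_def l0)
    ultimately show ?thesis by (rule rev_finite_subset)
  qed
  have lk: "Poly_Mapping.lookup (f x) \<gamma> = F x \<gamma>" if "x \<in> gcar M" for x \<gamma>
    using fin[OF that] that by (simp add: f_def)
  have "is_ghom (gshift a M) Ek f"
  proof (rule is_ghomI)
    show "graded_module (gshift a M)" ..
    show "module (gact Ek :: ('a, 'b) mpoly \<Rightarrow> _)" by (simp add: Ek_def module_inv_act)
  next
    fix x y assume "x \<in> gcar (gshift a M)" "y \<in> gcar (gshift a M)"
    then have xy: "x \<in> gcar M" "y \<in> gcar M" by auto
    show "f (x + y) = f x + f y"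
    proof (rule poly_mapping_eqI)
      fix \<gamma>
      show "Poly_Mapping.lookup (f (x + y)) \<gamma> = Poly_Mapping.lookup (f x + f y) \<gamma>"
        using l mem[OF xy(1)] mem[OF xy(2)] xy
        by (simp add: lk gcar_add lookup_add F_def hc_add scale_right_distrib klin_def)
    qed
  next
    fix \<beta> c x assume "x \<in> gcar (gshift a M)"
    then have x: "x \<in> gcar M" by auto
    show "f (gact (gshift a M) (Poly_Mapping.single \<beta> c) x) = gact Ek (Poly_Mapping.single \<beta> c) (f x)"
    proof (rule poly_mapping_eqI)
      fix \<gamma>
      have d: "- a - ideg \<gamma> - ideg \<beta> = - a - ideg (\<beta> + \<gamma>)" by (simp add: ideg_add algebra_simps)
      have "F (gact M (Poly_Mapping.single \<beta> c) x) \<gamma> = l (kscale M c (gact M (Xpow (\<beta> + \<gamma>)) (hc x (- a - ideg (\<beta> + \<gamma>)))))"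
        by (simp add: F_def hc_act[OF x] d Xpow_def kscale_def konst_def mult_single add.commute)
      also have "\<dots> = c * F x (\<beta> + \<gamma>)"
        using l mem[OF x] by (simp add: F_def klin_def)
      finally show "Poly_Mapping.lookup (f (gact (gshift a M) (Poly_Mapping.single \<beta> c) x)) \<gamma> =
         Poly_Mapping.lookup (gact Ek (Poly_Mapping.single \<beta> c) (f x)) \<gamma>"
        by (simp add: gshift_def lk gcar_act x Ek_def lookup_inv_act_single)
    qed
  next
    fix b x assume "x \<in> gcomp (gshift a M) b"
    then have x: "x \<in> gcomp M (b - a)" by (simp add: gshift_def)
    have "- ideg \<gamma> = b" if "F x \<gamma> \<noteq> 0" for \<gamma>
    proof -
      have "- a - ideg \<gamma> = b - a" using that by (auto simp: F_def hc_comp[OF x] l0 split: if_splits)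
      then show ?thesis by (metis diff_add_cancel minus_diff_commute)
    qed
    then show "f x \<in> gcomp Ek b"
      by (auto simp: Ek_def in_keys_iff lk[OF gcar_comp[OF x]])
  qed
  moreover have "Poly_Mapping.lookup (f m) 0 = l m" if "m \<in> gcomp M (- a)" for m
    by (simp add: lk gcar_comp[OF that] F_def hc_comp[OF that] Xpow_def)
  ultimately show ?thesis
    by (auto simp: mdual_comp_iff f_def)
qed


lemma matlis_elem:
  assumes "graded_module M" "klin M (gcomp M (- a)) l"
  shows "matlis_elem M a l \<in> gcomp (mdual M) a"
    and "m \<in> gcomp M (- a) \<Longrightarrow> Poly_Mapping.lookup (matlis_elem M a l m) 0 = l m"
proof -
  have "\<exists>!f. f \<in> gcomp (mdual M) a \<and> (\<forall>m\<in>gcomp M (- a). Poly_Mapping.lookup (f m) 0 = l m)"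
    using mdual_exists[OF assms] mdual_eqI[OF assms(1)] by metis
  from theI'[OF this] show "matlis_elem M a l \<in> gcomp (mdual M) a"
    "m \<in> gcomp M (- a) \<Longrightarrow> Poly_Mapping.lookup (matlis_elem M a l m) 0 = l m"
    unfolding matlis_elem_def by auto
qed

text \<open>
  \<open>Ek\<close> is a graded injective hull of \<open>k\<close>: by \<open>Ek_socle\<close> the multiples of \<open>X\<^sup>0\<close> form a copy of
  \<open>R/(X\<^sub>1, \<dots>, X\<^sub>n)\<close>, by \<open>Ek_essential\<close> every nonzero submodule meets it, and \<open>Ek_injective\<close> is
  injectivity, for graded modules over arbitrary types.
\<close>

lemma Ek_socle: "gact Ek r (Poly_Mapping.single 0 c) = Poly_Mapping.single 0 (Poly_Mapping.lookup r 0 * c)"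
proof (rule poly_mapping_eqI)
  fix \<gamma> :: "'a \<Rightarrow> nat"
  have "\<beta> + \<gamma> = 0 \<longleftrightarrow> \<beta> = 0 \<and> \<gamma> = 0" for \<beta>
    by (auto simp: fun_eq_iff)
  then show "Poly_Mapping.lookup (gact Ek r (Poly_Mapping.single 0 c)) \<gamma> = Poly_Mapping.lookup (Poly_Mapping.single 0 (Poly_Mapping.lookup r 0 * c)) \<gamma>"
    by (cases "\<gamma> = 0") (auto simp: Ek_def lookup_inv_act lookup_single when_def in_keys_iff eq_commute[of 0]
      if_distrib[of "\<lambda>x. _ * x"] sum.delta cong: if_cong)
qed

lemma Ek_essential:
  fixes x :: "('n::finite \<Rightarrow> nat) \<Rightarrow>\<^sub>0 'k::field"
  assumes "x \<noteq> 0"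
  shows "\<exists>r. gact Ek r x = Poly_Mapping.single 0 1"
proof -
  let ?d = "\<lambda>\<gamma>. \<Sum>i\<in>UNIV. \<gamma> i"
  from assms have "Poly_Mapping.keys x \<noteq> {}" by simp
  then obtain \<gamma> where \<gamma>: "\<gamma> \<in> Poly_Mapping.keys x" "\<forall>\<delta>\<in>Poly_Mapping.keys x. ?d \<delta> \<le> ?d \<gamma>"
    using Max_in[of "?d ` Poly_Mapping.keys x"] Max_ge[of "?d ` Poly_Mapping.keys x"] by fastforce
  have "Poly_Mapping.lookup x (\<gamma> + \<delta>) = 0" if "\<delta> \<noteq> 0" for \<delta>
  proof (rule ccontr)
    assume "Poly_Mapping.lookup x (\<gamma> + \<delta>) \<noteq> 0"
    then have "?d (\<gamma> + \<delta>) \<le> ?d \<gamma>" using \<gamma>(2)[rule_format, of "\<gamma> + \<delta>"] by (simp add: in_keys_iff)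
    then have "?d \<delta> = 0" by (simp add: sum.distrib)
    then show False using that by (auto simp: fun_eq_iff)
  qed
  then have "gact Ek (Poly_Mapping.single \<gamma> (1 / Poly_Mapping.lookup x \<gamma>)) x = Poly_Mapping.single 0 1"
    using \<gamma>(1) by (intro poly_mapping_eqI) (auto simp: Ek_def lookup_inv_act_single lookup_one lookup_single when_def in_keys_iff)
  then show ?thesis by blast
qed

lemma (in graded_module) vector_space_kscale: "vector_space (kscale M)"
  by standard (simp_all add: kscale_def konst_def scale_right_distrib scale_left_distrib single_add mult_single)

lemma klin_extend:
  assumes "graded_module M" and V: "module.subspace (kscale M) V" and l: "klin M V l"
  shows "\<exists>l'. klin M UNIV l' \<and> (\<forall>v\<in>V. l' v = l v)"
proof -
  interpret M: graded_module M by fact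
  interpret vector_space "kscale M" by (rule M.vector_space_kscale)
  interpret P: vector_space_pair "kscale M" "(*) :: 'b \<Rightarrow> 'b \<Rightarrow> 'b"
    by standard (auto simp: algebra_simps)
  obtain B where B: "B \<subseteq> V" "independent B" "V \<subseteq> span B" using maximal_independent_subset[of V] by blast
  obtain l' where l': "Vector_Spaces.linear (kscale M) (*) l'" "\<forall>x\<in>B. l' x = l x"
    using P.linear_independent_extend[OF B(2)] by blast
  have L: "l' (x + y) = l' x + l' y" "l' (kscale M c x) = c * l' x" for x y c
    by (rule P.linear_add[OF l'(1)], rule P.linear_scale[OF l'(1)])
  have "0 \<in> V" using V by (rule subspace_0)
  then have "l (0 + 0) = l 0 + l 0" using l unfolding klin_def by blast
  then have z: "l' 0 = 0" "l 0 = 0" using L(1)[of 0 0] by (metis add.right_neutral add_left_cancel)+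
  have "x \<in> V \<and> l' x = l x" if "x \<in> span B" for x
    using that
  proof (induction rule: span_induct_alt)
    case base then show ?case using z V subspace_0 by auto
  next
    case (step c x y)
    then have "x \<in> V" "y \<in> V" "kscale M c x \<in> V" using B V by (auto intro: subspace_scale)
    then show ?case using step l'(2) l V by (auto simp: L klin_def intro: subspace_add)
  qed
  then show ?thesis using B L by (intro exI[of _ l']) (auto simp: klin_def)
qed

lemma gshift_0 [simp]: "gshift 0 M = M"
  by (simp add: gshift_def)

lemma Ek_injective:
  assumes "graded_module M" "graded_module N" and j: "is_ghom M N j" "inj_on j (gcar M)" and f: "is_ghom M Ek f"
  shows "\<exists>g. is_ghom N Ek g \<and> (\<forall>x\<in>gcar M. g (j x) = f x)"
proof -
  interpret M: graded_module M by fact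
  interpret N: graded_module N by fact
  interpret E: graded_module Ek by (rule graded_module_Ek)
  interpret V: vector_space "kscale N" by (rule N.vector_space_kscale)
  define V where "V = j ` gcomp M 0"
  define l0 where "l0 w = Poly_Mapping.lookup (f (inv_into (gcar M) j w)) 0" for w
  have jadd: "j (x + y) = j x + j y" if "x \<in> gcomp M 0" "y \<in> gcomp M 0" for x y
    using j that M.gcar_comp unfolding is_ghom_def by blast
  have jsc: "j (kscale M c x) = kscale N c (j x)" if "x \<in> gcomp M 0" for x c
    using j that M.gcar_comp unfolding is_ghom_def kscale_def by blast
  have l0: "l0 (j x) = Poly_Mapping.lookup (f x) 0" if "x \<in> gcomp M 0" for x
    using that j(2) by (simp add: l0_def inv_into_f_f M.gcar_comp)
  have V0: "0 \<in> V" using jadd[OF M.comp_zero M.comp_zero] M.comp_zero unfolding V_def by (auto intro!: image_eqI[of _ _ 0])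
  have "V.subspace V"
  proof (rule V.subspaceI)
    fix x y c assume "x \<in> V"
    then show "kscale N c x \<in> V" by (auto simp: V_def simp flip: jsc intro: M.comp_scale)
    assume "y \<in> V"
    then show "x + y \<in> V" using \<open>x \<in> V\<close> by (auto simp: V_def simp flip: jadd intro: M.comp_add)
  qed (rule V0)
  moreover have "klin N V l0"
  proof -
    have "f (x + y) = f x + f y" if "x \<in> gcomp M 0" "y \<in> gcomp M 0" for x y
      using f that M.gcar_comp unfolding is_ghom_def by blast
    moreover have "f (kscale M c x) = inv_act (konst c) (f x)" if "x \<in> gcomp M 0" for x c
      using f that M.gcar_comp unfolding is_ghom_def kscale_def Ek_def by simp
    ultimately show ?thesis
      by (auto simp: klin_def V_def l0 M.comp_add M.comp_scale lookup_add konst_def lookup_inv_act_single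
         simp flip: jadd jsc)
  qed
  ultimately obtain l where l: "klin N UNIV l" "\<forall>v\<in>V. l v = l0 v"
    using klin_extend[OF assms(2)] by blast
  obtain g where g: "g \<in> gcomp (mdual N) 0" "\<forall>m\<in>gcomp N 0. Poly_Mapping.lookup (g m) 0 = l m"
    using mdual_exists[OF assms(2), of 0 l] l(1) by (auto simp: klin_def)
  have jcar: "j x \<in> gcar N" if "x \<in> gcar M" for x
    using that
  proof (induction x rule: M.gcar_induct)
    case (comp a x) then show ?case using j N.gcar_comp unfolding is_ghom_def by blast
  next
    case (add x y) then show ?case using j N.gcar_add unfolding is_ghom_def by simp
  qed
  have gh: "is_ghom N Ek g" using g by (simp add: mdual_comp_iff)
  have "(\<lambda>x. if x \<in> gcar M then g (j x) else 0) = (\<lambda>x. if x \<in> gcar M then f x else 0)"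
  proof (rule mdual_eqI[OF assms(1), of _ 0])
    show "(\<lambda>x. if x \<in> gcar M then g (j x) else 0) \<in> gcomp (mdual M) 0"
      using gh j(1) by (auto simp: mdual_comp_iff is_ghom_def M.gcar_add M.gcar_act jcar M.gcar_comp image_subset_iff)
    show "(\<lambda>x. if x \<in> gcar M then f x else 0) \<in> gcomp (mdual M) 0"
      using f by (auto simp: mdual_comp_iff is_ghom_def M.gcar_add M.gcar_act M.gcar_comp image_subset_iff)
    fix m assume "m \<in> gcomp M (- 0)"
    then show "Poly_Mapping.lookup (if m \<in> gcar M then g (j m) else 0) 0 = Poly_Mapping.lookup (if m \<in> gcar M then f m else 0) 0"
      using g(2) l(2) j(1) by (auto simp: l0 V_def is_ghom_def image_subset_iff)
  qed
  then show ?thesis using gh by (metis (mono_tags, lifting))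
qed

lemma gact_Rtensor: "gact (Rtensor M V) = tact M"
  by (simp add: Rtensor_def)

context graded_module
begin

lemma kscale_add_right: "kscale M c (x + y) = kscale M c x + kscale M c y"
  by (simp add: kscale_def scale_right_distrib)
lemma kscale_add_left: "kscale M (c + d) x = kscale M c x + kscale M d x"
  by (simp add: kscale_def konst_def scale_left_distrib single_add)
lemma kscale_kscale: "kscale M c (kscale M d x) = kscale M (c * d) x"
  by (simp add: kscale_def konst_def mult_single)
lemma kscale_zero [simp]: "kscale M 0 x = 0" "kscale M c 0 = 0"
  by (simp_all add: kscale_def konst_def)
lemma kscale_one [simp]: "kscale M 1 x = x"
  by (simp add: kscale_def konst_def)

lemma tact_superset:
  assumes "finite K" "Poly_Mapping.keys r \<subseteq> K" "finite L" "Poly_Mapping.keys t \<subseteq> L"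
  shows "tact M r t = (\<Sum>\<beta>\<in>K. \<Sum>\<gamma>\<in>L.
        Poly_Mapping.single (\<beta> + \<gamma>) (kscale M (Poly_Mapping.lookup r \<beta>) (Poly_Mapping.lookup t \<gamma>)))"
proof -
  have "tact M r t = (\<Sum>\<beta>\<in>Poly_Mapping.keys r. \<Sum>\<gamma>\<in>L.
        Poly_Mapping.single (\<beta> + \<gamma>) (kscale M (Poly_Mapping.lookup r \<beta>) (Poly_Mapping.lookup t \<gamma>)))"
    unfolding tact_def by (intro sum.cong refl sum.mono_neutral_left) (use assms in \<open>auto simp: in_keys_iff\<close>)
  also have "\<dots> = (\<Sum>\<beta>\<in>K. \<Sum>\<gamma>\<in>L.
        Poly_Mapping.single (\<beta> + \<gamma>) (kscale M (Poly_Mapping.lookup r \<beta>) (Poly_Mapping.lookup t \<gamma>)))"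
    by (intro sum.mono_neutral_left) (use assms in \<open>auto simp: in_keys_iff\<close>)
  finally show ?thesis .
qed

lemma tact_add_left: "tact M (r + s) t = tact M r t + tact M s t"
  by (subst (1 2 3) tact_superset[of "Poly_Mapping.keys r \<union> Poly_Mapping.keys s" _ "Poly_Mapping.keys t"])
     (use keys_add[of r s] in \<open>auto simp: lookup_add kscale_add_left single_add sum.distrib\<close>)

lemma tact_add_right: "tact M r (t + u) = tact M r t + tact M r u"
  by (subst (1 2 3) tact_superset[of "Poly_Mapping.keys r" _ "Poly_Mapping.keys t \<union> Poly_Mapping.keys u"])
     (use keys_add[of t u] in \<open>auto simp: lookup_add kscale_add_right single_add sum.distrib\<close>)

lemma tact_0 [simp]: "tact M 0 t = 0" "tact M r 0 = 0"
  by (simp_all add: tact_def)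

lemma tact_single: "tact M (Poly_Mapping.single \<beta> c) (Poly_Mapping.single \<gamma> v) = Poly_Mapping.single (\<beta> + \<gamma>) (kscale M c v)"
  by (subst tact_superset[of "{\<beta>}" _ "{\<gamma>}"]) auto

lemma tact_mult: "tact M r (tact M s t) = tact M (r * s) t"
proof (induction r rule: pm_induct)
  case (single \<beta> c)
  show ?case
  proof (induction s rule: pm_induct)
    case (single \<gamma> d)
    show ?case
      by (induction t rule: pm_induct) (simp_all add: tact_single mult_single kscale_kscale add.assoc tact_add_right)
  qed (simp_all add: tact_add_left tact_add_right algebra_simps)
qed (simp_all add: tact_add_left algebra_simps)

lemma tact_one: "tact M 1 t = t"
  by (induction t rule: pm_induct) (simp_all add: tact_add_right tact_single flip: single_one)

lemma module_tact: "module (tact M)"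
  by standard (simp_all add: tact_add_left tact_add_right tact_mult tact_one)

lemma ptensor_superset: "finite K \<Longrightarrow> Poly_Mapping.keys r \<subseteq> K \<Longrightarrow>
  ptensor M r v = (\<Sum>\<beta>\<in>K. Poly_Mapping.single \<beta> (kscale M (Poly_Mapping.lookup r \<beta>) v))"
  unfolding ptensor_def by (rule sum.mono_neutral_left) (auto simp: in_keys_iff)

lemma ptensor_add_left: "ptensor M (r + s) v = ptensor M r v + ptensor M s v"
  by (subst (1 2 3) ptensor_superset[of "Poly_Mapping.keys r \<union> Poly_Mapping.keys s"])
     (use keys_add[of r s] in \<open>auto simp: lookup_add kscale_add_left single_add sum.distrib\<close>)

lemma ptensor_add_right: "ptensor M r (v + w) = ptensor M r v + ptensor M r w"
  by (simp add: ptensor_def kscale_add_right single_add sum.distrib)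

lemma ptensor_single: "ptensor M (Poly_Mapping.single \<beta> c) v = Poly_Mapping.single \<beta> (kscale M c v)"
  by (subst ptensor_superset[of "{\<beta>}"]) auto

lemma ptensor_0 [simp]: "ptensor M 0 v = 0" "ptensor M r 0 = 0"
  by (simp_all add: ptensor_def)

lemma ptensor_mult: "ptensor M (s * r) v = tact M s (ptensor M r v)"
proof (induction s rule: pm_induct)
  case (single \<beta> c)
  show ?case
    by (induction r rule: pm_induct)
       (simp_all add: mult_single ptensor_single tact_single kscale_kscale ptensor_add_left tact_add_right algebra_simps)
qed (simp_all add: ptensor_add_left tact_add_left algebra_simps)

lemma ptensor_konst: "ptensor M (konst c * r) v = ptensor M r (kscale M c v)"
proof (induction r rule: pm_induct)
  case (single k d)
  show ?case by (simp add: konst_def mult_single ptensor_single kscale_kscale mult.commute)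
qed (simp_all add: ptensor_add_left algebra_simps)

end

lemma gcar_sumI: "finite A \<Longrightarrow> \<forall>a\<in>A. x a \<in> gcomp M a \<Longrightarrow> sum x A \<in> gcar M"
  unfolding gcar_def by blast

lemma Rtensor_carrier:
  fixes M :: "('n::finite, 'k::field, 'm::ab_group_add) gmod"
  assumes "graded_module M" "module.subspace (kscale M) V"
  shows "gcar (Rtensor M V) = {t. \<forall>\<gamma>. Poly_Mapping.lookup t \<gamma> \<in> V}"
proof -
  interpret M: graded_module M by fact
  interpret V: vector_space "kscale M" by (rule M.vector_space_kscale)
  show ?thesis
  proof (rule set_eqI, rule iffI)
    fix t assume "t \<in> gcar (Rtensor M V)"
    then show "t \<in> {t. \<forall>\<gamma>. Poly_Mapping.lookup t \<gamma> \<in> V}"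
      using assms(2) by (auto simp: gcar_def Rtensor_def lookup_sum intro!: V.subspace_sum)
  next
    fix t :: "('n \<Rightarrow> nat) \<Rightarrow>\<^sub>0 'm" assume t: "t \<in> {t. \<forall>\<gamma>. Poly_Mapping.lookup t \<gamma> \<in> V}"
    have inj: "inj_on ideg (Poly_Mapping.keys t)" by (auto simp: inj_on_def ideg_inj)
    let ?z = "\<lambda>a. let \<gamma> = inv_into (Poly_Mapping.keys t) ideg a in Poly_Mapping.single \<gamma> (Poly_Mapping.lookup t \<gamma>)"
    have "t = (\<Sum>a\<in>ideg ` Poly_Mapping.keys t. ?z a)"
      by (simp add: sum.reindex[OF inj] inj pm_sum_singles)
    moreover have "\<forall>a\<in>ideg ` Poly_Mapping.keys t. ?z a \<in> gcomp (Rtensor M V) a"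
      using t V.subspace_0[OF assms(2)] inj by (auto simp: Rtensor_def lookup_single when_def)
    ultimately show "t \<in> gcar (Rtensor M V)"
      using gcar_sumI[of "ideg ` Poly_Mapping.keys t" ?z] by simp
  qed
qed

text \<open>
  Universal property of \<open>R \<otimes>\<^sub>k V\<close>: every \<open>k\<close>-bilinear map on \<open>R \<times> V\<close> factors uniquely through \<open>ptensor\<close>.
\<close>

lemma Rtensor_universal:
  assumes M: "graded_module M" and V: "module.subspace (kscale M) V" and sP: "vector_space sP"
    and b1: "\<And>r s v. v \<in> V \<Longrightarrow> b (r + s) v = b r v + b s v"
    and b2: "\<And>r v w. v \<in> V \<Longrightarrow> w \<in> V \<Longrightarrow> b r (v + w) = b r v + b r w"
    and b3: "\<And>c r v. v \<in> V \<Longrightarrow> b (konst c * r) v = sP c (b r v)"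
    and b4: "\<And>c r v. v \<in> V \<Longrightarrow> b r (kscale M c v) = sP c (b r v)"
  shows "\<exists>L. (\<forall>t\<in>gcar (Rtensor M V). \<forall>u\<in>gcar (Rtensor M V). L (t + u) = L t + L u) \<and>
     (\<forall>c. \<forall>t\<in>gcar (Rtensor M V). L (gact (Rtensor M V) (konst c) t) = sP c (L t)) \<and>
     (\<forall>r. \<forall>v\<in>V. L (ptensor M r v) = b r v)" (is "\<exists>L. ?A L \<and> ?B L \<and> ?C L")
    and "\<And>L L'. \<lbrakk>\<And>t u. t \<in> gcar (Rtensor M V) \<Longrightarrow> u \<in> gcar (Rtensor M V) \<Longrightarrow> L (t + u) = L t + L u;
       \<And>t u. t \<in> gcar (Rtensor M V) \<Longrightarrow> u \<in> gcar (Rtensor M V) \<Longrightarrow> L' (t + u) = L' t + L' u;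
       \<And>r v. v \<in> V \<Longrightarrow> L (ptensor M r v) = L' (ptensor M r v); t \<in> gcar (Rtensor M V)\<rbrakk> \<Longrightarrow> L t = L' t"
proof -
  interpret M: graded_module M by fact
  interpret V: vector_space "kscale M" by (rule M.vector_space_kscale)
  interpret P: vector_space sP by fact
  note car = Rtensor_carrier[OF M V]
  have V0: "0 \<in> V" using V by (rule V.subspace_0)
  have b0: "b r 0 = 0" for r using b2[OF V0 V0, of r] by simp
  have b0': "b 0 v = 0" if "v \<in> V" for v using b1[OF that, of 0 0] by simp
  define L where "L t = (\<Sum>\<gamma>\<in>Poly_Mapping.keys t. b (Xpow \<gamma>) (Poly_Mapping.lookup t \<gamma>))" for t
  have L: "L t = (\<Sum>\<gamma>\<in>K. b (Xpow \<gamma>) (Poly_Mapping.lookup t \<gamma>))" if "finite K" "Poly_Mapping.keys t \<subseteq> K" for t K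
    unfolding L_def by (rule sum.mono_neutral_left) (use that in \<open>auto simp: in_keys_iff b0\<close>)
  have Ladd: "L (t + u) = L t + L u" if "t \<in> gcar (Rtensor M V)" "u \<in> gcar (Rtensor M V)" for t u
    by (subst (1 2 3) L[of "Poly_Mapping.keys t \<union> Poly_Mapping.keys u"])
       (use that keys_add[of t u] car in \<open>auto simp: lookup_add b2 sum.distrib\<close>)
  have pc: "ptensor M r v \<in> gcar (Rtensor M V)" if "v \<in> V" for r v
    unfolding car ptensor_def
    using V that V0 by (auto simp: lookup_sum lookup_single when_def intro!: V.subspace_sum V.subspace_scale)
  have Lp: "L (ptensor M r v) = b r v" if v: "v \<in> V" for r v
  proof (induction r rule: pm_induct)
    case zero show ?case using b0'[OF v] by (simp add: L_def)
  next
    case (single k c)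
    have "L (Poly_Mapping.single k (kscale M c v)) = b (Xpow k) (kscale M c v)"
      by (subst L[of "{k}"]) auto
    also have "\<dots> = b (konst c * Xpow k) v" by (simp add: b4[OF v] b3[OF v])
    also have "konst c * Xpow k = Poly_Mapping.single k c" by (simp add: konst_def Xpow_def mult_single)
    finally show ?case by (simp add: M.ptensor_single)
  next
    case (add p q)
    then show ?case by (simp add: M.ptensor_add_left Ladd[OF pc pc] v b1[OF v])
  qed
  have Lsc: "L (tact M (konst c) t) = sP c (L t)" if "t \<in> gcar (Rtensor M V)" for c t
  proof -
    have lk: "Poly_Mapping.lookup (tact M (konst c) t) \<gamma> = kscale M c (Poly_Mapping.lookup t \<gamma>)" for \<gamma>
    proof (induction t rule: pm_induct)
      case (single k d)
      then show ?case by (simp add: konst_def M.tact_single lookup_single when_def)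
    qed (simp_all add: M.tact_add_right lookup_add M.kscale_add_right)
    show ?thesis
      by (subst (1 2) L[of "Poly_Mapping.keys t"])
         (use that car in \<open>auto simp: in_keys_iff lk b4 P.scale_sum_right\<close>)
  qed
  show "\<exists>L. ?A L \<and> ?B L \<and> ?C L"
    using Ladd Lsc Lp by (intro exI[of _ L]) (auto simp: gact_Rtensor)
  fix L1 L2 t
  assume L1: "\<And>t u. t \<in> gcar (Rtensor M V) \<Longrightarrow> u \<in> gcar (Rtensor M V) \<Longrightarrow> L1 (t + u) = L1 t + L1 u"
    and L2: "\<And>t u. t \<in> gcar (Rtensor M V) \<Longrightarrow> u \<in> gcar (Rtensor M V) \<Longrightarrow> L2 (t + u) = L2 t + L2 u"
    and eq: "\<And>r v. v \<in> V \<Longrightarrow> L1 (ptensor M r v) = L2 (ptensor M r v)" and t: "t \<in> gcar (Rtensor M V)"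
  have "finite K \<Longrightarrow> L1 (\<Sum>\<gamma>\<in>K. ptensor M (Xpow \<gamma>) (Poly_Mapping.lookup t \<gamma>)) = L2 (\<Sum>\<gamma>\<in>K. ptensor M (Xpow \<gamma>) (Poly_Mapping.lookup t \<gamma>))
     \<and> (\<Sum>\<gamma>\<in>K. ptensor M (Xpow \<gamma>) (Poly_Mapping.lookup t \<gamma>)) \<in> gcar (Rtensor M V)" for K
  proof (induction K rule: finite_induct)
    case empty
    then show ?case using eq[OF V0, of 0] V0 by (simp add: car)
  next
    case (insert x F)
    have m: "ptensor M (Xpow x) (Poly_Mapping.lookup t x) \<in> gcar (Rtensor M V)"
      by (rule pc) (use t car in auto)
    moreover have "p + q \<in> gcar (Rtensor M V)" if "p \<in> gcar (Rtensor M V)" "q \<in> gcar (Rtensor M V)" for p q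
      using that by (auto simp: car lookup_add intro: V.subspace_add[OF V])
    ultimately show ?case using insert t by (auto simp: L1 L2 eq car)
  qed
  from this[of "Poly_Mapping.keys t"] show "L1 t = L2 t"
    by (simp add: Xpow_def M.ptensor_single pm_sum_singles)
qed

lemma phi_hat_ptensor:
  assumes "graded_module M"
  shows "phi_hat M (\<lambda>h. if h = g then ptensor M r m else 0) = gact M r m"
proof -
  interpret M: graded_module M by fact
  have 1: "phi_hat M (\<lambda>h. if h = g then t else 0) = (\<Sum>\<gamma>\<in>Poly_Mapping.keys t. gact M (Xpow \<gamma>) (Poly_Mapping.lookup t \<gamma>))" for t
  proof (cases "t = 0")
    case False
    then have "{h. (if h = g then t else 0) \<noteq> 0} = {g}" by auto
    then show ?thesis by (simp add: phi_hat_def)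
  qed (simp add: phi_hat_def)
  have 2: "ptensor M r m = (\<Sum>\<beta>\<in>Poly_Mapping.keys r. Poly_Mapping.single \<beta> (kscale M (Poly_Mapping.lookup r \<beta>) m))"
    by (simp add: ptensor_def)
  have lk: "Poly_Mapping.lookup (ptensor M r m) \<gamma> = kscale M (Poly_Mapping.lookup r \<gamma>) m" for \<gamma>
    by (induction r rule: pm_induct) (auto simp: M.ptensor_single lookup_single when_def M.ptensor_add_left lookup_add M.kscale_add_left)
  have "(\<Sum>\<gamma>\<in>Poly_Mapping.keys (ptensor M r m). gact M (Xpow \<gamma>) (Poly_Mapping.lookup (ptensor M r m) \<gamma>))
    = (\<Sum>\<gamma>\<in>Poly_Mapping.keys r. gact M (Xpow \<gamma>) (Poly_Mapping.lookup (ptensor M r m) \<gamma>))"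
    by (rule sum.mono_neutral_left) (auto simp: in_keys_iff lk)
  also have "\<dots> = (\<Sum>\<gamma>\<in>Poly_Mapping.keys r. gact M (Poly_Mapping.single \<gamma> (Poly_Mapping.lookup r \<gamma>)) m)"
    by (simp add: lk kscale_def Xpow_def konst_def mult_single)
  also have "\<dots> = gact M r m"
    by (simp add: pm_sum_singles flip: M.scale_sum_left)
  finally show ?thesis unfolding 1 .
qed

end

theory Submission
  imports Defs
begin

text \<open>
  Everything reduces to finite-dimensional linear algebra in single degrees.  Restriction to
  \<open>M\<^sub>g\<close> identifies the degree \<open>-g\<close> component of the Matlis dual of \<open>M\<close> with the \<open>k\<close>-dual of
  \<open>M\<^sub>g\<close>, and the dual basis is the family corresponding to the coordinate functionals \<open>coord g \<mu>\<close>
  (\<open>dual_basis_lookup\<close>); hence it is a basis of that component (\<open>dual_basis_expand\<close>).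

  Both identifications are isomorphisms because each expresses an object by its coordinates.  An
  element of \<open>R \<otimes> M\<^sub>h\<close>, seen as a polynomial with coefficients in \<open>M\<^sub>h\<close>, is recovered from the
  polynomials formed by the coordinates of its coefficients (\<open>F_ident_iso\<close>).  A \<open>k\<close>-linear map on
  the degree \<open>-g\<close> component of the Matlis dual is determined by its values on the dual basis, and
  these can be prescribed (\<open>E_ident_iso\<close>).

  For the matrix, the map \<open>F_M \<rightarrow> M\<close> sends a family \<open>x\<close> to \<open>m = \<Sum> x\<^sub>j e\<^sub>j\<close> (\<open>phi_hat_F_ident\<close>), and
  the component of \<open>M \<rightarrow> E_M\<close> at the dual basis vector \<open>f\<close> is the orbit map \<open>r \<mapsto> r \<cdot> f(m)\<close>
  (\<open>composite_apply\<close>).  If \<open>f\<close> has degree \<open>-g\<close> and \<open>m\<close> has degree \<open>h\<close>, this orbit map lies in the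
  degree \<open>h - g\<close> component of the Matlis dual of \<open>R\<close>.  That component is zero unless \<open>h \<le> g\<close>, and is
  otherwise spanned by one cogenerator; the multiple is read off by testing on \<open>X\<^bsup>g-h\<^esup>\<close>, which gives
  the constant term of \<open>f(X\<^bsup>g-h\<^esup> m)\<close> (\<open>orbit_eq_cogen\<close>).  For \<open>m = e (h,\<nu>)\<close> and \<open>f\<close> dual to
  \<open>e (g,\<mu>)\<close> this is by definition the entry of the monomial matrix.
\<close>

section \<open>Isomorphisms of graded modules\<close>

lemma sum_fun_apply: "(\<Sum>i\<in>K. h i) x = (\<Sum>i\<in>K. h i x)" for h :: "'i \<Rightarrow> 'a \<Rightarrow> 'b::comm_monoid_add"
  by (induction K rule: infinite_finite_induct) auto

text \<open>
  Surjectivity only has to be checked on homogeneous elements, since these generate the target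
  additively.
\<close>

lemma is_gisoI:
  assumes f: "is_ghom M N f" and inj: "inj_on f (gcar M)"
    and surj: "\<And>a y. y \<in> gcomp N a \<Longrightarrow> \<exists>x\<in>gcomp M a. f x = y"
  shows "is_giso M N f"
proof -
  have car: "sum x A \<in> gcar M" if "finite A" "\<forall>a\<in>A. x a \<in> gcomp M a" for x A
    using that by (rule gcar_sumI)
  have car1: "y \<in> gcar M" if "y \<in> gcomp M a" for y a
    using car[of "{a}" "\<lambda>_. y"] that by simp
  have "0 \<in> gcar M" using car[of "{}"] by simp
  then have "f (0 + 0) = f 0 + f 0" using f by (simp only: is_ghom_def)
  then have f0: "f 0 = 0" by simp
  have sum: "f (sum x A) = (\<Sum>a\<in>A. f (x a))" if "finite A" "\<forall>a\<in>A. x a \<in> gcomp M a" for x A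
    using that
  proof (induction A rule: finite_induct)
    case (insert a A)
    have "x a \<in> gcar M" "sum x A \<in> gcar M" using insert car car1 by blast+
    then have "f (x a + sum x A) = f (x a) + f (sum x A)" using f by (simp only: is_ghom_def)
    then show ?case using insert by simp
  qed (simp add: f0)
  have "f ` gcar M = gcar N"
  proof (intro equalityI subsetI)
    fix y assume "y \<in> f ` gcar M"
    then obtain A x where A: "finite A" "\<forall>a\<in>A. x a \<in> gcomp M a" "y = (\<Sum>a\<in>A. f (x a))"
      by (auto simp: gcar_def sum)
    moreover have "f z \<in> gcomp N a" if "z \<in> gcomp M a" for a z
      using f that by (auto simp: is_ghom_def image_subset_iff)
    ultimately show "y \<in> gcar N" by (auto intro: gcar_sumI)
  next
    fix y assume "y \<in> gcar N"
    then obtain A z where A: "finite A" "\<forall>a\<in>A. z a \<in> gcomp N a" "y = sum z A"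
      by (auto simp: gcar_def)
    have "\<forall>a\<in>A. \<exists>x. x \<in> gcomp M a \<and> f x = z a" using A(2) surj by blast
    from bchoice[OF this] obtain x where x: "\<forall>a\<in>A. x a \<in> gcomp M a \<and> f (x a) = z a" ..
    have "y = (\<Sum>a\<in>A. f (x a))" unfolding A(3) by (rule sum.cong) (simp_all add: x)
    also have "\<dots> = f (sum x A)" using A(1) x by (intro sum[symmetric]) blast+
    finally show "y \<in> f ` gcar M" using car[of A x] A x by blast
  qed
  then show ?thesis using f inj by (simp add: is_giso_def bij_betw_def)
qed

text \<open>
  An induction over sums of homogeneous elements for degreewise products and sums, which does not
  refer to the axioms of a graded module.
\<close>

lemma gcar_induct_additive:
  assumes "x \<in> gcar M" "P 0" "\<And>a x. x \<in> gcomp M a \<Longrightarrow> P x" "\<And>x y. P x \<Longrightarrow> P y \<Longrightarrow> P (x + y)"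
  shows "P x"
proof -
  have "P (sum z A)" if "finite A" "\<forall>a\<in>A. z a \<in> gcomp M a" for A z
    using that by (induction A rule: finite_induct) (use assms(2-4) in auto)
  then show ?thesis using assms(1) by (auto simp: gcar_def)
qed

lemma gdsum_compD: "x \<in> gcomp (gdsum I N) a \<Longrightarrow> i \<in> I \<Longrightarrow> x i \<in> gcomp (N i) a"
  by (simp add: gdsum_def)

lemma gcar_gdsum_off: "x \<in> gcar (gdsum I N) \<Longrightarrow> i \<notin> I \<Longrightarrow> x i = 0"
  by (rule gcar_induct_additive[of x "gdsum I N" "\<lambda>x. x i = 0"]) (auto simp: gdsum_def)

section \<open>The polynomial ring as a graded module\<close>

lemma graded_module_Rmod: "graded_module (Rmod :: ('n::finite, 'k::field, _) gmod)"
proof -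
  interpret module "gact Rmod :: ('n, 'k) mpoly \<Rightarrow> _"
    by standard (simp_all add: Rmod_def algebra_simps)
  show ?thesis
  proof
    fix a :: "'n deg" and x y :: "('n, 'k) mpoly"
    show "0 \<in> gcomp (Rmod :: ('n, 'k, _) gmod) a" by (simp add: Rmod_def)
    show "x \<in> gcomp Rmod a \<Longrightarrow> y \<in> gcomp Rmod a \<Longrightarrow> x + y \<in> gcomp Rmod a"
      using keys_add[of x y] by (auto simp: Rmod_def)
  next
    fix a :: "'n deg" and x :: "('n, 'k) mpoly" and \<beta> c
    assume "x \<in> gcomp Rmod a"
    then show "gact Rmod (Poly_Mapping.single \<beta> c) x \<in> gcomp Rmod (ideg \<beta> + a)"
      using keys_mult[of "Poly_Mapping.single \<beta> c" x]
      by (fastforce simp: Rmod_def ideg_add split: if_splits)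
  next
    fix A :: "'n deg set" and z b
    assume A: "finite A" and z: "\<And>a. a \<in> A \<Longrightarrow> z a \<in> gcomp (Rmod :: ('n, 'k, _) gmod) a"
      and s: "sum z A = 0" and b: "b \<in> A"
    show "z b = 0"
    proof (rule poly_mapping_eqI)
      fix \<gamma>
      show "Poly_Mapping.lookup (z b) \<gamma> = Poly_Mapping.lookup 0 \<gamma>"
      proof (cases "ideg \<gamma> = b")
        case False
        then show ?thesis using z[OF b] by (auto simp: Rmod_def in_keys_iff)
      next
        case True
        have "0 = (\<Sum>a\<in>A. Poly_Mapping.lookup (z a) \<gamma>)" using s by (simp flip: lookup_sum)
        also have "\<dots> = (\<Sum>a\<in>{b}. Poly_Mapping.lookup (z a) \<gamma>)"
          by (rule sum.mono_neutral_right) (use A b z True in \<open>auto simp: Rmod_def in_keys_iff\<close>)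
        finally show ?thesis by simp
      qed
    qed
  qed
qed

lemma gcar_Rmod: "gcar (Rmod :: ('n::finite, 'k::field, _) gmod) = UNIV"
proof -
  interpret R: graded_module "Rmod :: ('n, 'k, _) gmod" by (rule graded_module_Rmod)
  have "r \<in> gcar Rmod" for r :: "('n, 'k) mpoly"
  proof (induction r rule: pm_induct)
    case (single \<beta> c)
    then show ?case by (rule R.gcar_comp[of _ "ideg \<beta>"]) (simp add: Rmod_def)
  qed (auto intro: R.gcar_0 R.gcar_add)
  then show ?thesis by auto
qed

section \<open>Homogeneous components of Matlis duals\<close>

lemma gact_mdual: "gact (mdual M) r f = (\<lambda>x. inv_act r (f x))"
  by (simp add: mdual_def ghom_def Ek_def)

lemma kscale_mdual: "kscale (mdual M) c f = (\<lambda>x. inv_act (konst c) (f x))"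
  by (simp add: kscale_def gact_mdual)

lemma lookup_inv_act_konst:
  "Poly_Mapping.lookup (inv_act (konst c) x) \<gamma> = c * Poly_Mapping.lookup x \<gamma>"
  by (simp add: konst_def lookup_inv_act_single)

lemma inv_act_zero_right [simp]: "inv_act r 0 = 0"
  by (simp add: inv_act_def)

lemma inv_act_commute: "inv_act r (inv_act s x) = inv_act s (inv_act r x)"
  by (simp add: inv_act_mult mult.commute)

lemma Ek_comp_add:
  fixes x :: "('n::finite \<Rightarrow> nat) \<Rightarrow>\<^sub>0 'k::field"
  shows "x \<in> gcomp Ek a \<Longrightarrow> y \<in> gcomp Ek a \<Longrightarrow> x + y \<in> gcomp Ek a"
  by (rule graded_module.comp_add[OF graded_module_Ek])

lemma mdual_comp_zero:
  fixes M :: "('n::finite, 'k::field, 'm::ab_group_add) gmod"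
  shows "0 \<in> gcomp (mdual M) a"
  by (auto simp: mdual_comp_iff is_ghom_def Ek_def)

lemma mdual_comp_add:
  fixes M :: "('n::finite, 'k::field, 'm::ab_group_add) gmod"
  assumes "f \<in> gcomp (mdual M) a" "g \<in> gcomp (mdual M) a"
  shows "f + g \<in> gcomp (mdual M) a"
proof -
  have act: "h (gact (gshift a M) r x) = inv_act r (h x)"
    if "h \<in> gcomp (mdual M) a" "x \<in> gcar M" for h r x
    using that by (simp add: mdual_comp_iff is_ghom_def) (simp add: Ek_def)
  have "is_ghom (gshift a M) Ek (f + g)"
    unfolding is_ghom_def
  proof (intro conjI allI ballI)
    fix x y assume "x \<in> gcar (gshift a M)" "y \<in> gcar (gshift a M)"
    then show "(f + g) (x + y) = (f + g) x + (f + g) y"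
      using assms by (simp add: mdual_comp_iff is_ghom_def)
  next
    fix r x assume "x \<in> gcar (gshift a M)"
    then show "(f + g) (gact (gshift a M) r x) = gact Ek r ((f + g) x)"
      by (simp add: act assms) (simp add: Ek_def inv_act_add_right)
  next
    fix b
    show "(f + g) ` gcomp (gshift a M) b \<subseteq> gcomp Ek b"
      using assms by (auto simp: mdual_comp_iff is_ghom_def image_subset_iff intro!: Ek_comp_add)
  qed
  then show ?thesis
    using assms by (simp add: mdual_comp_iff)
qed

lemma mdual_comp_scale:
  fixes M :: "('n::finite, 'k::field, 'm::ab_group_add) gmod"
  assumes "f \<in> gcomp (mdual M) a"
  shows "kscale (mdual M) c f \<in> gcomp (mdual M) a"
proof -
  interpret E: graded_module "Ek :: ('n, 'k, _) gmod" by (rule graded_module_Ek)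
  have "inv_act (konst c) x \<in> gcomp Ek b" if "x \<in> gcomp Ek b" for b and x :: "('n \<Rightarrow> nat) \<Rightarrow>\<^sub>0 'k"
    using E.comp_scale[OF that, of c] by (simp add: kscale_def Ek_def)
  then have deg: "kscale (mdual M) c f ` gcomp (gshift a M) b \<subseteq> gcomp Ek b" for b
    using assms by (simp add: kscale_mdual mdual_comp_iff is_ghom_def image_subset_iff)
  have act: "f (gact (gshift a M) r x) = inv_act r (f x)" if "x \<in> gcar M" for r x
    using assms that by (simp add: mdual_comp_iff is_ghom_def) (simp add: Ek_def)
  have "is_ghom (gshift a M) Ek (kscale (mdual M) c f)"
    unfolding is_ghom_def
  proof (intro conjI allI ballI)
    fix x y assume "x \<in> gcar (gshift a M)" "y \<in> gcar (gshift a M)"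
    then show "kscale (mdual M) c f (x + y) = kscale (mdual M) c f x + kscale (mdual M) c f y"
      using assms by (simp add: kscale_mdual mdual_comp_iff is_ghom_def inv_act_add_right)
  next
    fix r x assume "x \<in> gcar (gshift a M)"
    then show "kscale (mdual M) c f (gact (gshift a M) r x) = gact Ek r (kscale (mdual M) c f x)"
      using inv_act_commute[of "konst c" r] by (simp add: kscale_mdual act) (simp add: Ek_def)
  qed (rule deg)
  then show ?thesis
    using assms by (simp add: mdual_comp_iff kscale_mdual)
qed

lemma mdual_comp_sum:
  fixes M :: "('n::finite, 'k::field, 'm::ab_group_add) gmod"
  shows "(\<And>i. i \<in> K \<Longrightarrow> f i \<in> gcomp (mdual M) a) \<Longrightarrow> sum f K \<in> gcomp (mdual M) a"
  by (induction K rule: infinite_finite_induct) (auto intro: mdual_comp_zero mdual_comp_add)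

lemma mdual_comp_add_arg:
  "f \<in> gcomp (mdual M) a \<Longrightarrow> x \<in> gcar M \<Longrightarrow> y \<in> gcar M \<Longrightarrow> f (x + y) = f x + f y"
  by (simp add: mdual_comp_iff is_ghom_def)

lemma mdual_comp_act_arg:
  assumes "f \<in> gcomp (mdual M) a" "x \<in> gcar M"
  shows "f (gact M r x) = inv_act r (f x)"
  using assms by (auto simp: mdual_comp_iff is_ghom_def) (simp add: gshift_def Ek_def)

lemma mdual_gcar_comp: "f \<in> gcomp (mdual M) a \<Longrightarrow> f \<in> gcar (mdual M)"
  unfolding gcar_def by (rule CollectI, rule exI[of _ "{a}"], rule exI[of _ "\<lambda>_. f"]) simp

text \<open>
  The elements of \<open>R\<^sup>\<or>\<close> occurring in the definition of the map \<open>M \<rightarrow> E_M\<close>: since \<open>R\<close> is free on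
  \<open>1\<close>, a homogeneous element \<open>y\<close> of \<open>E(k)\<close> extends to a homomorphism of the same degree, its orbit
  map.
\<close>

lemma orbit_in_Rdual:
  fixes y :: "('n::finite \<Rightarrow> nat) \<Rightarrow>\<^sub>0 'k::field"
  assumes "y \<in> gcomp Ek a"
  shows "(\<lambda>r. inv_act r y) \<in> gcomp Rdual a"
proof -
  have "inv_act r y \<in> gcomp Ek b" if r: "r \<in> gcomp Rmod (b - a)" for r and b
  proof -
    have "- ideg \<gamma> = b" if nz: "Poly_Mapping.lookup (inv_act r y) \<gamma> \<noteq> 0" for \<gamma>
    proof -
      from nz obtain \<beta> where \<beta>: "\<beta> \<in> Poly_Mapping.keys r" "Poly_Mapping.lookup y (\<beta> + \<gamma>) \<noteq> 0"
        unfolding lookup_inv_act by (metis (mono_tags, lifting) mult_zero_right sum.neutral)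
      from \<beta>(1) r have 1: "ideg \<beta> = b - a" by (simp add: Rmod_def)
      from \<beta>(2) assms have "a = - ideg (\<beta> + \<gamma>)" using Ek_comp_lookup by blast
      then have "a = - (b - a) - ideg \<gamma>" by (simp add: ideg_add 1)
      from fun_cong[OF this] show ?thesis by (auto simp: fun_eq_iff) (metis minus_minus)
    qed
    then show ?thesis by (auto simp: Ek_def in_keys_iff)
  qed
  then show ?thesis
    by (auto simp: mdual_comp_iff is_ghom_def gcar_Rmod inv_act_add_left gshift_def)
      (simp add: Rmod_def Ek_def inv_act_mult)
qed

section \<open>Coordinates and dual bases\<close>

(* Keeps the index sets {1..n} syntactically stable, so that facts about sums over them still match
   after simplification. *)
declare One_nat_def [simp del]

locale graded_basis = graded_module M
  for M :: "('n::finite, 'k::field, 'm::ab_group_add) gmod" +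
  fixes e :: "'n deg \<times> nat \<Rightarrow> 'm"
  assumes finite_supp: "finite (gsupp M)"
    and basis_supp: "g \<in> gsupp M \<Longrightarrow> basis_of_comp M e g"
begin

sublocale V: vector_space "kscale M" by (rule vector_space_kscale)

lemma gdim_off_supp: "g \<notin> gsupp M \<Longrightarrow> gdim M g = 0"
  using V.dim_span_eq_card_independent[OF V.independent_empty] by (simp add: gsupp_def gdim_def)

text \<open>
  In degrees outside the support the basis is empty, so the case distinction in the hypothesis
  disappears from all later arguments.
\<close>

lemma basis: "basis_of_comp M e g"
proof (cases "g \<in> gsupp M")
  case False
  then show ?thesis
    using gdim_off_supp[of g] by (simp add: basis_of_comp_def gsupp_def V.independent_empty)
qed (rule basis_supp)

abbreviation B where "B g \<equiv> e ` ({g} \<times> {1..gdim M g})"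

definition coord :: "'n deg \<Rightarrow> nat \<Rightarrow> 'm \<Rightarrow> 'k" where
  "coord g \<mu> m = V.representation (B g) m (e (g, \<mu>))"

lemma indep: "V.independent (B g)" and span_B: "V.span (B g) = gcomp M g"
  and inj_e: "inj_on e ({g} \<times> {1..gdim M g})"
  using basis[of g] by (auto simp: basis_of_comp_def)

lemma e_comp: "\<nu> \<in> {1..gdim M g} \<Longrightarrow> e (g, \<nu>) \<in> gcomp M g"
  unfolding span_B[symmetric] by (rule V.span_base) auto

lemma sum_B: "(\<Sum>b\<in>B g. f b) = (\<Sum>\<nu>=1..gdim M g. f (e (g, \<nu>)))"
proof -
  have "(\<Sum>b\<in>B g. f b) = (\<Sum>x\<in>{g} \<times> {1..gdim M g}. f (e x))"
    using sum.reindex[OF inj_e, of f g] by (simp only: o_def)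
  also have "\<dots> = (\<Sum>x\<in>Pair g ` {1..gdim M g}. f (e x))" by (rule sum.cong) auto
  also have "\<dots> = (\<Sum>\<nu>=1..gdim M g. f (e (g, \<nu>)))"
    by (subst sum.reindex) (simp_all add: inj_on_def)
  finally show ?thesis .
qed

lemma coord_expand:
  assumes "m \<in> gcomp M g"
  shows "(\<Sum>\<nu>=1..gdim M g. kscale M (coord g \<nu> m) (e (g, \<nu>))) = m"
proof -
  have "(\<Sum>b\<in>B g. kscale M (V.representation (B g) m b) b) = m"
    using assms by (intro V.sum_representation_eq indep) (simp_all add: span_B)
  then show ?thesis by (simp only: sum_B coord_def)
qed

lemma coord_add: "x \<in> gcomp M g \<Longrightarrow> y \<in> gcomp M g \<Longrightarrow> coord g \<mu> (x + y) = coord g \<mu> x + coord g \<mu> y"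
  unfolding coord_def by (subst V.representation_add[OF indep]) (auto simp: span_B)

lemma coord_scale: "x \<in> gcomp M g \<Longrightarrow> coord g \<mu> (kscale M c x) = c * coord g \<mu> x"
  unfolding coord_def by (subst V.representation_scale[OF indep]) (auto simp: span_B)

lemma coord_e:
  assumes "\<mu> \<in> {1..gdim M g}" "\<nu> \<in> {1..gdim M g}"
  shows "coord g \<mu> (e (g, \<nu>)) = (if \<nu> = \<mu> then 1 else 0)"
proof -
  have "e (g, \<nu>) = e (g, \<mu>) \<longleftrightarrow> \<nu> = \<mu>" 
    using inj_on_eq_iff[OF inj_e, of "(g, \<nu>)" g "(g, \<mu>)"] assms by simp
  then show ?thesis
    unfolding coord_def using assms by (subst V.representation_basis[OF indep]) auto
qed

lemma coord_comb:
  assumes "\<mu> \<in> {1..gdim M g}"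
  shows "coord g \<mu> (\<Sum>\<nu>=1..gdim M g. kscale M (c \<nu>) (e (g, \<nu>))) = c \<mu>"
proof -
  have "coord g \<mu> (\<Sum>\<nu>\<in>K. kscale M (c \<nu>) (e (g, \<nu>))) = (\<Sum>\<nu>\<in>K. c \<nu> * coord g \<mu> (e (g, \<nu>)))"
    if "finite K" "K \<subseteq> {1..gdim M g}" for K
    using that
  proof (induction K rule: finite_induct)
    case empty
    then show ?case using coord_scale[OF comp_zero, of g \<mu> 0] by simp
  next
    case (insert \<nu> K)
    then show ?case
      using e_comp[of \<nu> g] by (subst sum.insert) (auto simp: coord_add[OF comp_scale comp_sum[OF comp_scale[OF e_comp]]] coord_scale subset_iff)
  qed
  from this[of "{1..gdim M g}"] assms show ?thesis
    by (simp add: coord_e if_distrib[of "\<lambda>x. _ * x"] cong: if_cong)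
qed

lemma klin_coord: "klin M (gcomp M g) (coord g \<mu>)"
  by (simp add: klin_def coord_add coord_scale)

text \<open>
  An element \<open>f\<close> of the Matlis dual is determined in its degree by the constant term of its values, so
  the three lemmas below say that \<open>dual_basis M e (g, \<mu>)\<close> is the functional \<open>coord g \<mu>\<close> in disguise.
\<close>

lemma dual_basis_eq: "dual_basis M e (g, \<mu>) = matlis_elem M (- g) (coord g \<mu>)"
  unfolding dual_basis_def coord_def[abs_def] prod.case ..

lemma dual_basis_comp: "dual_basis M e (g, \<mu>) \<in> gcomp (mdual M) (- g)"
  unfolding dual_basis_eq by (rule matlis_elem(1)[OF graded_module_axioms]) (simp add: klin_coord)

lemma dual_basis_lookup:
  "m \<in> gcomp M g \<Longrightarrow> Poly_Mapping.lookup (dual_basis M e (g, \<mu>) m) 0 = coord g \<mu> m"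
  unfolding dual_basis_eq by (rule matlis_elem(2)[OF graded_module_axioms]) (simp_all add: klin_coord)

text \<open>
  The usual expansion of a functional in a dual basis, its coefficients being its values on the
  basis; it transfers from functionals on \<open>M\<^sub>g\<close> to the Matlis dual by \<open>mdual_eqI\<close>.
\<close>

lemma dual_basis_expand:
  assumes "f \<in> gcomp (mdual M) (- g)"
  shows "(\<Sum>\<mu>=1..gdim M g. kscale (mdual M) (Poly_Mapping.lookup (f (e (g, \<mu>))) 0) (dual_basis M e (g, \<mu>))) = f"
    (is "?S = f")
proof (rule mdual_eqI[OF graded_module_axioms _ assms])
  show "?S \<in> gcomp (mdual M) (- g)"
    by (intro mdual_comp_sum mdual_comp_scale dual_basis_comp)
  fix m assume "m \<in> gcomp M (- (- g))"
  then have m: "m \<in> gcomp M g" by simp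
  have f_comb: "Poly_Mapping.lookup (f (\<Sum>\<nu>\<in>K. kscale M (c \<nu>) (e (g, \<nu>)))) 0
      = (\<Sum>\<nu>\<in>K. c \<nu> * Poly_Mapping.lookup (f (e (g, \<nu>))) 0)"
    if "finite K" "K \<subseteq> {1..gdim M g}" for K c
    using that
  proof (induction K rule: finite_induct)
    case empty
    have "f 0 = 0" using mdual_comp_add_arg[OF assms gcar_0 gcar_0] by simp
    then show ?case by simp
  next
    case (insert \<nu> K)
    have "e (g, \<rho>) \<in> gcar M" if "\<rho> \<in> insert \<nu> K" for \<rho>
      using insert.prems that gcar_comp e_comp by blast
    moreover from this have "(\<Sum>\<nu>\<in>K. kscale M (c \<nu>) (e (g, \<nu>))) \<in> gcar M"
      by (intro gcar_sum) (simp add: kscale_def gcar_act)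
    ultimately show ?case
      using insert
      by (simp add: mdual_comp_add_arg[OF assms] kscale_def gcar_act mdual_comp_act_arg[OF assms]
          lookup_add lookup_inv_act_konst)
  qed
  have "Poly_Mapping.lookup (?S m) 0
      = (\<Sum>\<mu>=1..gdim M g. coord g \<mu> m * Poly_Mapping.lookup (f (e (g, \<mu>))) 0)"
    by (simp add: sum_fun_apply lookup_sum kscale_mdual lookup_inv_act_konst dual_basis_lookup[OF m] mult.commute)
  also have "\<dots> = Poly_Mapping.lookup (f m) 0"
    using f_comb[of "{1..gdim M g}" "\<lambda>\<mu>. coord g \<mu> m"] coord_expand[OF m] by simp
  finally show "Poly_Mapping.lookup (?S m) 0 = Poly_Mapping.lookup (f m) 0" .
qed

section \<open>The identification of the free module\<close>

definition basis_index :: "('n deg \<times> nat) set" where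
  "basis_index = (\<Union>g\<in>gsupp M. {g} \<times> {1..gdim M g})"

lemma basis_index_iff: "(g, \<mu>) \<in> basis_index \<longleftrightarrow> \<mu> \<in> {1..gdim M g}"
  using gdim_off_supp[of g] by (cases "g \<in> gsupp M") (auto simp: basis_index_def)

lemma finite_basis_index: "finite basis_index"
  by (simp add: basis_index_def finite_supp)

lemma lookup_ptensor: "Poly_Mapping.lookup (ptensor M r v) \<gamma> = kscale M (Poly_Mapping.lookup r \<gamma>) v"
  by (induction r rule: pm_induct)
    (auto simp: ptensor_single lookup_single when_def ptensor_add_left lookup_add kscale_add_left)

lemma lookup_F_ident: "Poly_Mapping.lookup (F_ident M e x h) \<gamma>
    = (\<Sum>\<nu>=1..gdim M h. kscale M (Poly_Mapping.lookup (x (h, \<nu>)) \<gamma>) (e (h, \<nu>)))"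
  by (simp add: F_ident_def lookup_sum lookup_ptensor)

lemma F_ident_hom: "is_ghom (free_mod basis_index fst) (FM M) (F_ident M e)"
  unfolding is_ghom_def
proof (intro conjI allI ballI)
  fix x y :: "'n deg \<times> nat \<Rightarrow> ('n, 'k) mpoly"
  show "F_ident M e (x + y) = F_ident M e x + F_ident M e y"
    by (simp add: F_ident_def fun_eq_iff ptensor_add_left sum.distrib)
next
  interpret T: module "tact M" by (rule module_tact)
  fix r and x :: "'n deg \<times> nat \<Rightarrow> ('n, 'k) mpoly"
  show "F_ident M e (gact (free_mod basis_index fst) r x) = gact (FM M) r (F_ident M e x)"
    by (simp add: F_ident_def fun_eq_iff FM_def free_mod_def gdsum_def gshift_def Rmod_def Rtensor_def
        ptensor_mult T.scale_sum_right)
next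
  fix a
  show "F_ident M e ` gcomp (free_mod basis_index fst) a \<subseteq> gcomp (FM M) a"
  proof (rule image_subsetI)
    fix x :: "'n deg \<times> nat \<Rightarrow> ('n, 'k) mpoly"
    assume x: "x \<in> gcomp (free_mod basis_index fst) a"
    have "finite {h. F_ident M e x h \<noteq> 0}"
    proof (rule finite_subset[OF _ finite_supp], rule subsetI, rule ccontr)
      fix h assume "h \<in> {h. F_ident M e x h \<noteq> 0}" "h \<notin> gsupp M"
      then show False by (simp add: F_ident_def gdim_off_supp)
    qed
    moreover have "Poly_Mapping.lookup (F_ident M e x h) \<gamma> \<in> gcomp M h" for h \<gamma>
      unfolding lookup_F_ident by (intro comp_sum comp_scale e_comp)
    moreover have "ideg \<gamma> = a - h" if "\<gamma> \<in> Poly_Mapping.keys (F_ident M e x h)" for h \<gamma>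
    proof -
      from that obtain \<nu> where \<nu>: "\<nu> \<in> {1..gdim M h}" "Poly_Mapping.lookup (x (h, \<nu>)) \<gamma> \<noteq> 0"
        unfolding in_keys_iff lookup_F_ident by (metis (no_types, lifting) kscale_zero(1) sum.neutral)
      then have "x (h, \<nu>) \<in> gcomp Rmod (a - h)"
        using x gdsum_compD[of x basis_index "\<lambda>j. gshift (fst j) Rmod" a "(h, \<nu>)"]
        by (simp add: free_mod_def gshift_def basis_index_iff)
      then show ?thesis using \<nu>(2) by (simp add: Rmod_def in_keys_iff)
    qed
    ultimately show "F_ident M e x \<in> gcomp (FM M) a"
      by (simp add: FM_def gdsum_def gshift_def Rtensor_def)
  qed
qed

text \<open>
  Coefficientwise, \<open>F_ident\<close> is the passage from coordinates to vectors of \<open>M\<^sub>h\<close>; the inverse applies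
  the coordinate functionals to each coefficient.
\<close>

lemma F_ident_iso: "is_giso (free_mod basis_index fst) (FM M) (F_ident M e)"
proof (rule is_gisoI[OF F_ident_hom])
  show "inj_on (F_ident M e) (gcar (free_mod basis_index fst))"
  proof (rule inj_onI, rule ext, clarify)
    fix x y h \<nu>
    assume x: "x \<in> gcar (free_mod basis_index fst)" and y: "y \<in> gcar (free_mod basis_index fst)"
      and eq: "F_ident M e x = F_ident M e y"
    show "x (h, \<nu>) = y (h, \<nu>)"
    proof (cases "(h, \<nu>) \<in> basis_index")
      case True
      show ?thesis
      proof (rule poly_mapping_eqI)
        fix \<gamma>
        have "coord h \<nu> (Poly_Mapping.lookup (F_ident M e x h) \<gamma>)
            = coord h \<nu> (Poly_Mapping.lookup (F_ident M e y h) \<gamma>)" by (simp only: eq)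
        then show "Poly_Mapping.lookup (x (h, \<nu>)) \<gamma> = Poly_Mapping.lookup (y (h, \<nu>)) \<gamma>"
          using True by (simp only: lookup_F_ident basis_index_iff coord_comb)
      qed
    next
      case False
      then show ?thesis using x y gcar_gdsum_off by (metis free_mod_def)
    qed
  qed
next
  fix a y assume y: "y \<in> gcomp (FM M) a"
  define x where "x = (\<lambda>(h, \<nu>). if (h, \<nu>) \<in> basis_index then Poly_Mapping.map (coord h \<nu>) (y h) else 0)"
  have c0: "coord h \<nu> 0 = 0" for h \<nu> using coord_scale[OF comp_zero, of h \<nu> 0] by simp
  have lk: "Poly_Mapping.lookup (x (h, \<nu>)) \<gamma> = coord h \<nu> (Poly_Mapping.lookup (y h) \<gamma>)"
    if "\<nu> \<in> {1..gdim M h}" for h \<nu> \<gamma>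
    using that by (simp add: x_def basis_index_iff Poly_Mapping.map.rep_eq when_def c0)
  have "x (h, \<nu>) \<in> gcomp Rmod (a - h)" if "\<nu> \<in> {1..gdim M h}" for h \<nu>
  proof -
    have "ideg \<gamma> = a - h" if "Poly_Mapping.lookup (y h) \<gamma> \<noteq> 0" for \<gamma>
      using y that by (simp add: FM_def gdsum_def gshift_def Rtensor_def in_keys_iff)
    moreover have "Poly_Mapping.lookup (y h) \<gamma> \<noteq> 0" if "\<gamma> \<in> Poly_Mapping.keys (x (h, \<nu>))" for \<gamma>
      using that c0[of h \<nu>] lk[OF \<open>\<nu> \<in> {1..gdim M h}\<close>, of \<gamma>] by (auto simp: in_keys_iff)
    ultimately show ?thesis by (simp add: Rmod_def)
  qed
  moreover have "x j = 0" if "j \<notin> basis_index" for j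
    using that by (cases j) (simp add: x_def)
  moreover from this have "finite {j. x j \<noteq> 0}"
    by (intro finite_subset[OF _ finite_basis_index]) auto
  ultimately have "x \<in> gcomp (free_mod basis_index fst) a"
    by (auto simp: free_mod_def gdsum_def gshift_def basis_index_iff)
  moreover have "F_ident M e x = y"
  proof (rule ext, rule poly_mapping_eqI)
    fix h \<gamma>
    have "Poly_Mapping.lookup (F_ident M e x h) \<gamma>
        = (\<Sum>\<nu>=1..gdim M h. kscale M (coord h \<nu> (Poly_Mapping.lookup (y h) \<gamma>)) (e (h, \<nu>)))"
      unfolding lookup_F_ident by (rule sum.cong) (simp_all add: lk)
    also have "\<dots> = Poly_Mapping.lookup (y h) \<gamma>"
      using y by (intro coord_expand) (simp add: FM_def gdsum_def gshift_def Rtensor_def)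
    finally show "Poly_Mapping.lookup (F_ident M e x h) \<gamma> = Poly_Mapping.lookup (y h) \<gamma>" .
  qed
  ultimately show "\<exists>x\<in>gcomp (free_mod basis_index fst) a. F_ident M e x = y" by blast
qed

section \<open>The identification of the cofree module\<close>

lemma E_ident_apply:
  "E_ident M e \<theta> (g, \<mu>) = (if (g, \<mu>) \<in> basis_index then \<theta> (- g) (dual_basis M e (g, \<mu>)) else 0)"
  by (simp add: E_ident_def basis_index_def)

lemma EM_compD:
  assumes "\<theta> \<in> gcomp (EM M) a"
  shows "f \<in> gcomp (mdual M) h \<Longrightarrow> \<theta> h f \<in> gcomp Rdual (a + h)"
    and "f \<notin> gcomp (mdual M) h \<Longrightarrow> \<theta> h f = 0"
    and "f \<in> gcomp (mdual M) h \<Longrightarrow> f' \<in> gcomp (mdual M) h \<Longrightarrow> \<theta> h (f + f') = \<theta> h f + \<theta> h f'"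
    and "f \<in> gcomp (mdual M) h \<Longrightarrow> \<theta> h (kscale (mdual M) c f) = kscale Rdual c (\<theta> h f)"
  using assms by (simp_all add: EM_def gprod_def homk_def gshift_def kscale_def)

text \<open>
  A member of \<open>E_M\<close> is determined by its values on the dual bases.  For homogeneous members this is
  linearity combined with \<open>dual_basis_expand\<close>.  The claim is phrased as an identity that is additive
  in \<open>\<theta>\<close>, and so it passes to sums of homogeneous members.
\<close>

lemma EM_expand:
  assumes "\<theta> \<in> gcar (EM M)"
  shows "\<theta> (- g) f = (if f \<in> gcomp (mdual M) (- g)
    then \<Sum>\<mu>=1..gdim M g. kscale Rdual (Poly_Mapping.lookup (f (e (g, \<mu>))) 0) (\<theta> (- g) (dual_basis M e (g, \<mu>)))
    else 0)"
  using assms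
proof (rule gcar_induct_additive[of \<theta> "EM M" "\<lambda>\<theta>. \<theta> (- g) f = (if f \<in> gcomp (mdual M) (- g)
    then \<Sum>\<mu>=1..gdim M g. kscale Rdual (Poly_Mapping.lookup (f (e (g, \<mu>))) 0) (\<theta> (- g) (dual_basis M e (g, \<mu>)))
    else 0)"], goal_cases)
  case 1
  then show ?case by (auto simp: kscale_mdual fun_eq_iff sum_fun_apply)
next
  case (2 a \<theta>)
  have z: "\<theta> (- g) 0 = 0" using EM_compD(3)[OF 2(1) mdual_comp_zero mdual_comp_zero, of "- g"] by simp
  have *: "\<theta> (- g) (\<Sum>\<mu>\<in>K. kscale (mdual M) (c \<mu>) (dual_basis M e (g, \<mu>)))
      = (\<Sum>\<mu>\<in>K. kscale Rdual (c \<mu>) (\<theta> (- g) (dual_basis M e (g, \<mu>))))" if "finite K" for K c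
    using that
  proof (induction K rule: finite_induct)
    case (insert \<mu> K)
    then show ?case
      unfolding sum.insert[OF insert.hyps]
      by (simp only: EM_compD(3,4)[OF 2(1)] mdual_comp_scale mdual_comp_sum dual_basis_comp)
  qed (simp only: sum.empty z)
  show ?case
  proof (cases "f \<in> gcomp (mdual M) (- g)")
    case True
    then show ?thesis
      using *[of "{1..gdim M g}" "\<lambda>\<mu>. Poly_Mapping.lookup (f (e (g, \<mu>))) 0"] dual_basis_expand[OF True]
      by simp
  qed (simp add: EM_compD(2)[OF 2(1)])
next
  case (3 \<theta> \<theta>')
  then show ?case
    by (auto simp: kscale_mdual fun_eq_iff sum_fun_apply inv_act_add_right sum.distrib)
qed

lemma E_ident_hom: "is_ghom (EM M) (cofree_mod basis_index fst) (E_ident M e)"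
  unfolding is_ghom_def
proof (intro conjI allI ballI)
  fix \<theta> \<theta>' :: "'n deg \<Rightarrow> ('m \<Rightarrow> (('n \<Rightarrow> nat) \<Rightarrow>\<^sub>0 'k)) \<Rightarrow> (('n, 'k) mpoly \<Rightarrow> (('n \<Rightarrow> nat) \<Rightarrow>\<^sub>0 'k))"
  show "E_ident M e (\<theta> + \<theta>') = E_ident M e \<theta> + E_ident M e \<theta>'"
    by (rule ext, clarify) (simp add: E_ident_apply)
next
  fix r and \<theta> :: "'n deg \<Rightarrow> ('m \<Rightarrow> (('n \<Rightarrow> nat) \<Rightarrow>\<^sub>0 'k)) \<Rightarrow> (('n, 'k) mpoly \<Rightarrow> (('n \<Rightarrow> nat) \<Rightarrow>\<^sub>0 'k))"
  show "E_ident M e (gact (EM M) r \<theta>) = gact (cofree_mod basis_index fst) r (E_ident M e \<theta>)"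
    by (rule ext, clarify)
      (simp add: E_ident_apply EM_def gprod_def homk_def gshift_def cofree_mod_def gdsum_def gact_mdual fun_eq_iff)
next
  fix a
  show "E_ident M e ` gcomp (EM M) a \<subseteq> gcomp (cofree_mod basis_index fst) a"
  proof (rule image_subsetI)
    fix \<theta> :: "'n deg \<Rightarrow> ('m \<Rightarrow> (('n \<Rightarrow> nat) \<Rightarrow>\<^sub>0 'k)) \<Rightarrow> (('n, 'k) mpoly \<Rightarrow> (('n \<Rightarrow> nat) \<Rightarrow>\<^sub>0 'k))"
    assume \<theta>: "\<theta> \<in> gcomp (EM M) a"
    have off: "E_ident M e \<theta> i = 0" if "i \<notin> basis_index" for i
      using that by (cases i) (simp add: E_ident_apply)
    then have "finite {i. E_ident M e \<theta> i \<noteq> 0}"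
      by (intro finite_subset[OF _ finite_basis_index]) auto
    with off show "E_ident M e \<theta> \<in> gcomp (cofree_mod basis_index fst) a"
      using EM_compD(1)[OF \<theta> dual_basis_comp]
      by (auto simp: cofree_mod_def gdsum_def gshift_def E_ident_apply)
  qed
qed

text \<open>
  Surjectivity holds because the values on a basis can be prescribed: the preimage of \<open>y\<close> is the
  linear extension \<open>\<theta>\<close> of the assignment sending the dual basis vectors to the entries of \<open>y\<close>.
\<close>

lemma E_ident_iso: "is_giso (EM M) (cofree_mod basis_index fst) (E_ident M e)"
proof (rule is_gisoI[OF E_ident_hom])
  show "inj_on (E_ident M e) (gcar (EM M))"
  proof (intro inj_onI ext[of "_ :: 'n deg \<Rightarrow> _"])
    fix \<theta> \<theta>' h
    assume \<theta>: "\<theta> \<in> gcar (EM M)" "\<theta>' \<in> gcar (EM M)" and eq: "E_ident M e \<theta> = E_ident M e \<theta>'"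
    have D: "\<theta> (- (- h)) (dual_basis M e (- h, \<mu>)) = \<theta>' (- (- h)) (dual_basis M e (- h, \<mu>))"
      if "\<mu> \<in> {1..gdim M (- h)}" for \<mu>
      using fun_cong[OF eq, of "(- h, \<mu>)"] that by (simp add: E_ident_apply basis_index_iff)
    have "\<theta> (- (- h)) f = \<theta>' (- (- h)) f" for f
      by (subst EM_expand[OF \<theta>(1)], subst EM_expand[OF \<theta>(2)], intro if_cong sum.cong refl)
        (simp only: D)
    then show "\<theta> h = \<theta>' h" by (simp add: fun_eq_iff)
  qed
next
  fix a and y :: "'n deg \<times> nat \<Rightarrow> ('n, 'k) mpoly \<Rightarrow> (('n \<Rightarrow> nat) \<Rightarrow>\<^sub>0 'k)"
  assume y: "y \<in> gcomp (cofree_mod basis_index fst) a"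
  define \<theta> where "\<theta> h f = (if f \<in> gcomp (mdual M) h
    then \<Sum>\<mu>=1..gdim M (- h). kscale Rdual (Poly_Mapping.lookup (f (e (- h, \<mu>))) 0) (y (- h, \<mu>))
    else 0)" for h f
  have y_comp: "y (- h, \<mu>) \<in> gcomp Rdual (a + h)" if "\<mu> \<in> {1..gdim M (- h)}" for h \<mu>
    using y that gdsum_compD[of y basis_index "\<lambda>i. gshift (fst i) Rdual" a "(- h, \<mu>)"]
    by (simp add: cofree_mod_def gshift_def basis_index_iff)
  have "\<theta> h f \<in> gcomp Rdual (a + h)" if "f \<in> gcomp (mdual M) h" for h f
    using that by (auto simp: \<theta>_def intro!: mdual_comp_sum mdual_comp_scale y_comp)
  moreover have "\<theta> h (f + f') = \<theta> h f + \<theta> h f'"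
    if "f \<in> gcomp (mdual M) h" "f' \<in> gcomp (mdual M) h" for h f f'
    using that mdual_comp_add[OF that]
    by (simp add: \<theta>_def lookup_add kscale_mdual konst_def single_add inv_act_add_left fun_eq_iff
        sum_fun_apply sum.distrib)
  moreover have "\<theta> h (kscale (mdual M) c f) = kscale Rdual c (\<theta> h f)"
    if "f \<in> gcomp (mdual M) h" for h c f
  proof -
    interpret E: module inv_act by (rule module_inv_act)
    show ?thesis
      using that mdual_comp_scale[OF that, of c]
      by (simp add: \<theta>_def kscale_mdual lookup_inv_act_konst fun_eq_iff sum_fun_apply
          E.scale_sum_right inv_act_mult) (simp add: konst_def mult_single)
  qed
  ultimately have "\<theta> \<in> gcomp (EM M) a"
    by (simp add: EM_def gprod_def homk_def gshift_def kscale_def \<theta>_def)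
  moreover have "E_ident M e \<theta> = y"
  proof (rule ext, clarify)
    fix g \<mu>
    show "E_ident M e \<theta> (g, \<mu>) = y (g, \<mu>)"
    proof (cases "(g, \<mu>) \<in> basis_index")
      case True
      then have \<mu>: "\<mu> \<in> {1..gdim M g}" by (simp add: basis_index_iff)
      have "E_ident M e \<theta> (g, \<mu>)
          = (\<Sum>\<nu>=1..gdim M g. kscale Rdual (if \<nu> = \<mu> then 1 else 0) (y (g, \<nu>)))"
      proof -
        have "E_ident M e \<theta> (g, \<mu>) = (\<Sum>\<nu>=1..gdim M g. kscale Rdual
            (Poly_Mapping.lookup (dual_basis M e (g, \<mu>) (e (g, \<nu>))) 0) (y (g, \<nu>)))"
          using True by (simp add: E_ident_apply \<theta>_def dual_basis_comp)
        then show ?thesis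
          using \<mu> by (auto intro!: sum.cong simp: dual_basis_lookup e_comp coord_e)
      qed
      also have "\<dots> = (\<Sum>\<nu>=1..gdim M g. if \<nu> = \<mu> then y (g, \<nu>) else 0)"
        by (intro sum.cong refl) (auto simp: kscale_mdual fun_eq_iff konst_def poly_mapping_eq_iff lookup_inv_act_single)
      finally show ?thesis using \<mu> by simp
    next
      case False
      then show ?thesis using y by (simp add: E_ident_apply cofree_mod_def gdsum_def)
    qed
  qed
  ultimately show "\<exists>\<theta>\<in>gcomp (EM M) a. E_ident M e \<theta> = y" by blast
qed

section \<open>The composite and its matrix\<close>

lemma Rmod_act_comp:
  assumes "r \<in> gcomp Rmod a" "m \<in> gcomp M b"
  shows "gact M r m \<in> gcomp M (a + b)"
proof -
  have "gact M r m
      = (\<Sum>\<beta>\<in>Poly_Mapping.keys r. gact M (Poly_Mapping.single \<beta> (Poly_Mapping.lookup r \<beta>)) m)"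
    by (simp add: pm_sum_singles flip: scale_sum_left)
  also have "\<dots> \<in> gcomp M (a + b)"
  proof (rule comp_sum)
    fix \<beta> assume "\<beta> \<in> Poly_Mapping.keys r"
    then have "ideg \<beta> = a" using assms(1) by (simp add: Rmod_def)
    then show "gact M (Poly_Mapping.single \<beta> (Poly_Mapping.lookup r \<beta>)) m \<in> gcomp M (a + b)"
      using comp_act[OF assms(2), of \<beta> "Poly_Mapping.lookup r \<beta>"] by simp
  qed
  finally show ?thesis .
qed

text \<open>
  On each summand \<open>R \<otimes> M\<^sub>g\<close> the map is the additive \<open>P\<close> sending \<open>r \<otimes> m\<close> to \<open>r m\<close>, and \<open>F_ident\<close> produces
  sums of such tensors.
\<close>

lemma phi_hat_F_ident: "phi_hat M (F_ident M e x) = (\<Sum>j\<in>basis_index. gact M (x j) (e j))"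
proof -
  define P where "P t = (\<Sum>\<gamma>\<in>Poly_Mapping.keys t. gact M (Xpow \<gamma>) (Poly_Mapping.lookup t \<gamma>))"
    for t :: "('n \<Rightarrow> nat) \<Rightarrow>\<^sub>0 'm"
  have P_on: "P t = (\<Sum>\<gamma>\<in>K. gact M (Xpow \<gamma>) (Poly_Mapping.lookup t \<gamma>))"
    if "finite K" "Poly_Mapping.keys t \<subseteq> K" for t K
    unfolding P_def by (rule sum.mono_neutral_left) (use that in \<open>auto simp: in_keys_iff\<close>)
  have P0: "P 0 = 0" by (simp add: P_def)
  have P_add: "P (s + t) = P s + P t" for s t
    using keys_add[of s t]
    by (simp add: P_on[of "Poly_Mapping.keys s \<union> Poly_Mapping.keys t"] lookup_add
        scale_right_distrib sum.distrib)
  have P_sum: "P (\<Sum>i\<in>K. t i) = (\<Sum>i\<in>K. P (t i))" for K and t :: "nat \<Rightarrow> _"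
    by (induction K rule: infinite_finite_induct) (simp_all add: P0 P_add)
  have "phi_hat M (\<lambda>h. if h = 0 then t else 0) = P t" for t
  proof (cases "t = 0")
    case False
    then have "{h. (if h = 0 then t else 0) \<noteq> 0} = {0 :: 'n deg}" by auto
    then show ?thesis by (simp add: phi_hat_def P_def)
  qed (simp add: phi_hat_def P0)
  then have P_ptensor: "P (ptensor M r m) = gact M r m" for r m
    using phi_hat_ptensor[OF graded_module_axioms] by metis
  have off: "F_ident M e x g = 0" if "g \<notin> gsupp M" for g
    using that by (simp add: F_ident_def gdim_off_supp)
  have "phi_hat M (F_ident M e x) = (\<Sum>g | F_ident M e x g \<noteq> 0. P (F_ident M e x g))"
    by (simp add: phi_hat_def P_def)
  also have "\<dots> = (\<Sum>g\<in>gsupp M. P (F_ident M e x g))"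
    by (rule sum.mono_neutral_left) (use finite_supp off P0 in auto)
  also have "\<dots> = (\<Sum>g\<in>gsupp M. \<Sum>\<nu>=1..gdim M g. gact M (x (g, \<nu>)) (e (g, \<nu>)))"
    by (simp add: F_ident_def P_sum P_ptensor)
  also have "\<dots> = (\<Sum>j\<in>Sigma (gsupp M) (\<lambda>g. {1..gdim M g}). gact M (x j) (e j))"
    by (subst sum.Sigma) (auto simp: finite_supp split_def)
  also have "Sigma (gsupp M) (\<lambda>g. {1..gdim M g}) = basis_index"
    by (auto simp: basis_index_def)
  finally show ?thesis .
qed

lemma composite_apply: "(E_ident M e \<circ> phi M \<circ> F_ident M e) x = (\<lambda>i. if i \<in> basis_index
    then (\<lambda>r. inv_act r (dual_basis M e i (\<Sum>j\<in>basis_index. gact M (x j) (e j)))) else 0)"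
proof (rule ext, clarify)
  fix g \<mu>
  have "dual_basis M e (g, \<mu>) \<in> gcar (mdual M)"
    by (rule mdual_gcar_comp[OF dual_basis_comp])
  then show "(E_ident M e \<circ> phi M \<circ> F_ident M e) x (g, \<mu>) = (if (g, \<mu>) \<in> basis_index
    then (\<lambda>r. inv_act r (dual_basis M e (g, \<mu>) (\<Sum>j\<in>basis_index. gact M (x j) (e j)))) else 0)"
    using dual_basis_comp[of g \<mu>]
    by (simp only: E_ident_apply phi_def phi_check_def u_map_def o_def phi_hat_F_ident if_True)
      (simp add: Ek_def)
qed

lemma composite_is_ghom:
  "is_ghom (free_mod basis_index fst) (cofree_mod basis_index fst) (E_ident M e \<circ> phi M \<circ> F_ident M e)"
proof -
  define m where "m x = (\<Sum>j\<in>basis_index. gact M (x j) (e j))" for x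
  have e_basis_index: "e j \<in> gcomp M (fst j)" if "j \<in> basis_index" for j
    using that by (cases j) (simp add: basis_index_iff e_comp)
  have m_car: "m x \<in> gcar M" for x
    unfolding m_def by (intro gcar_sum gcar_act) (rule gcar_comp[OF e_basis_index])
  have m_add: "m (x + y) = m x + m y" for x y
    by (simp add: m_def scale_left_distrib sum.distrib)
  have m_act: "m (gact (free_mod basis_index fst) r x) = gact M r (m x)" for r x
    by (simp add: m_def free_mod_def gdsum_def gshift_def Rmod_def scale_sum_right)
  have m_comp: "m x \<in> gcomp M a" if x: "x \<in> gcomp (free_mod basis_index fst) a" for x a
    unfolding m_def
  proof (rule comp_sum)
    fix j assume j: "j \<in> basis_index"
    then have "x j \<in> gcomp Rmod (a - fst j)"
      using gdsum_compD[OF x[unfolded free_mod_def] j] by (simp add: gshift_def)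
    then show "gact M (x j) (e j) \<in> gcomp M a"
      using Rmod_act_comp[of "x j" "a - fst j", OF _ e_basis_index[OF j]] by simp
  qed
  have D: "dual_basis M e i \<in> gcomp (mdual M) (- fst i)" for i
    using dual_basis_comp by (cases i) simp
  show ?thesis
    unfolding is_ghom_def
  proof (intro conjI allI ballI)
    fix x y :: "'n deg \<times> nat \<Rightarrow> ('n, 'k) mpoly"
    show "(E_ident M e \<circ> phi M \<circ> F_ident M e) (x + y)
        = (E_ident M e \<circ> phi M \<circ> F_ident M e) x + (E_ident M e \<circ> phi M \<circ> F_ident M e) y"
      unfolding composite_apply m_def[symmetric] m_add
      by (rule ext) (simp add: mdual_comp_add_arg[OF D m_car m_car] inv_act_add_right fun_eq_iff)
  next
    fix r and x :: "'n deg \<times> nat \<Rightarrow> ('n, 'k) mpoly"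
    show "(E_ident M e \<circ> phi M \<circ> F_ident M e) (gact (free_mod basis_index fst) r x)
        = gact (cofree_mod basis_index fst) r ((E_ident M e \<circ> phi M \<circ> F_ident M e) x)"
      unfolding composite_apply m_def[symmetric] m_act
      by (rule ext) (simp add: mdual_comp_act_arg[OF D m_car] cofree_mod_def gdsum_def gshift_def
          gact_mdual fun_eq_iff inv_act_commute)
  next
    fix a
    show "(E_ident M e \<circ> phi M \<circ> F_ident M e) ` gcomp (free_mod basis_index fst) a \<subseteq> gcomp (cofree_mod basis_index fst) a"
    proof (rule image_subsetI)
      fix x :: "'n deg \<times> nat \<Rightarrow> ('n, 'k) mpoly"
      assume x: "x \<in> gcomp (free_mod basis_index fst) a"
      have "(\<lambda>r. inv_act r (dual_basis M e i (m x))) \<in> gcomp Rdual (a - fst i)" for i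
        using orbit_in_Rdual[OF mdual_comp_deg[OF D m_comp[OF x]]] by (simp only: add.commute diff_conv_add_uminus)
      moreover have "finite {i. (if i \<in> basis_index then (\<lambda>r. inv_act r (dual_basis M e i (m x))) else 0) \<noteq> 0}"
        by (rule finite_subset[OF _ finite_basis_index]) auto
      ultimately show "(E_ident M e \<circ> phi M \<circ> F_ident M e) x \<in> gcomp (cofree_mod basis_index fst) a"
        unfolding composite_apply m_def[symmetric] by (simp add: cofree_mod_def gdsum_def gshift_def)
    qed
  qed
qed

text \<open>
  Both sides lie in the degree \<open>h - g\<close> component of \<open>R\<^sup>\<or>\<close>, so it suffices to compare constant terms on
  \<open>R\<^bsub>g-h\<^esub>\<close>.  If \<open>h \<le> g\<close>, this is spanned by the single monomial \<open>X\<^bsup>g-h\<^esup>\<close>, and the claim is the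
  \<open>R\<close>-linearity of \<open>f\<close>; otherwise it is zero.
\<close>

lemma orbit_eq_cogen:
  assumes f: "f \<in> gcomp (mdual M) (- g)" and v: "v \<in> gcomp M h"
  shows "(\<lambda>r. inv_act r (f v))
    = kscale Rdual (Poly_Mapping.lookup (f (gact M (Xpow (nexp (g - h))) v)) 0) (cogen (h - g))"
    (is "_ = kscale _ ?c _")
proof (rule mdual_eqI[OF graded_module_Rmod, of _ "h - g"])
  let ?l = "\<lambda>r :: ('n, 'k) mpoly. Poly_Mapping.lookup r (nexp (- (h - g)))"
  have l: "klin Rmod (gcomp Rmod (- (h - g))) ?l"
  proof -
    have "?l (kscale Rmod c r) = c * ?l r" for c and r :: "('n, 'k) mpoly"
    proof (induction r rule: pm_induct)
      case (single \<beta> d)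
      then show ?case by (simp add: kscale_def Rmod_def konst_def mult_single lookup_single when_def)
    qed (simp_all add: kscale_def Rmod_def lookup_add algebra_simps)
    then show ?thesis by (simp add: klin_def lookup_add)
  qed
  show "(\<lambda>r. inv_act r (f v)) \<in> gcomp Rdual (h - g)"
    using orbit_in_Rdual[OF mdual_comp_deg[OF f v]] by (simp only: add.commute diff_conv_add_uminus)
  show "kscale Rdual ?c (cogen (h - g)) \<in> gcomp Rdual (h - g)"
    unfolding cogen_def by (intro mdual_comp_scale matlis_elem(1) graded_module_Rmod l)
  fix r :: "('n, 'k) mpoly"
  assume r: "r \<in> gcomp Rmod (- (h - g))"
  have keys: "Poly_Mapping.keys r \<subseteq> {nexp (g - h)}"
  proof
    fix \<beta> assume "\<beta> \<in> Poly_Mapping.keys r"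
    then have "ideg \<beta> = g - h" using r by (simp add: Rmod_def)
    moreover have "nexp (ideg \<beta>) = \<beta>" by (simp add: nexp_def ideg_def)
    ultimately show "\<beta> \<in> {nexp (g - h)}" by simp
  qed
  have "Poly_Mapping.lookup (inv_act r (f v)) 0
      = Poly_Mapping.lookup r (nexp (g - h)) * Poly_Mapping.lookup (f v) (nexp (g - h))"
    using lookup_inv_act'[OF _ keys, of "f v" 0] by simp
  also have "\<dots> = Poly_Mapping.lookup r (nexp (g - h)) * ?c"
    by (simp only: mdual_mult[OF f gcar_comp[OF v]])
  also have "\<dots> = ?c * Poly_Mapping.lookup (cogen (h - g) r) 0"
    using matlis_elem(2)[OF graded_module_Rmod l r] unfolding cogen_def
    by (simp only: minus_diff_eq mult.commute)
  finally show "Poly_Mapping.lookup (inv_act r (f v)) 0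
      = Poly_Mapping.lookup (kscale Rdual ?c (cogen (h - g)) r) 0"
    by (simp add: kscale_mdual lookup_inv_act_konst)
qed

text \<open>The value has degree \<open>h - g\<close>, and \<open>E(k)\<close> lives in degrees \<open>\<le> 0\<close>.\<close>

lemma pairing_vanishes:
  assumes f: "f \<in> gcomp (mdual M) (- g)" and v: "v \<in> gcomp M h" and "\<not> h \<le> g"
  shows "f v = 0"
proof (rule poly_mapping_eqI)
  fix \<gamma>
  have "- g + h \<noteq> - ideg \<gamma>"
  proof
    assume "- g + h = - ideg \<gamma>"
    then have "h = g - ideg \<gamma>" by (metis add_minus_cancel diff_conv_add_uminus)
    then have "h \<le> g" by (simp add: le_fun_def ideg_def)
    with assms(3) show False ..
  qed
  then show "Poly_Mapping.lookup (f v) \<gamma> = Poly_Mapping.lookup 0 \<gamma>"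
    using Ek_comp_lookup[OF mdual_comp_deg[OF f v]] by simp
qed

lemma composite_on_basis:
  assumes A_coeff: "\<And>g h \<nu>. g \<in> gsupp M \<Longrightarrow> (h, \<nu>) \<in> basis_index \<Longrightarrow> h \<le> g \<Longrightarrow>
        gact M (Xpow (nexp (g - h))) (e (h, \<nu>)) = (\<Sum>\<mu>=1..gdim M g. kscale M (A (g, \<mu>) (h, \<nu>)) (e (g, \<mu>)))"
    and j: "j \<in> basis_index"
  shows "(E_ident M e \<circ> phi M \<circ> F_ident M e) (\<lambda>j'. if j' = j then 1 else 0)
    = (\<lambda>i. if i \<in> basis_index \<and> fst j \<le> fst i then kscale Rdual (A i j) (cogen (fst j - fst i)) else 0)"
proof -
  obtain h \<nu> where j_eq: "j = (h, \<nu>)" by (cases j)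
  have ej: "e (h, \<nu>) \<in> gcomp M h" using j by (simp add: j_eq basis_index_iff e_comp)
  have m: "(\<Sum>j'\<in>basis_index. gact M (if j' = j then 1 else 0) (e j')) = e j"
  proof -
    have "(\<Sum>j'\<in>basis_index. gact M (if j' = j then 1 else 0) (e j')) = (\<Sum>j'\<in>basis_index. if j' = j then e j' else 0)"
      by (rule sum.cong) auto
    then show ?thesis using j finite_basis_index by simp
  qed
  have "(\<lambda>r. inv_act r (dual_basis M e (g, \<mu>) (e (h, \<nu>))))
      = (if h \<le> g then kscale Rdual (A (g, \<mu>) (h, \<nu>)) (cogen (h - g)) else 0)"
    if i: "(g, \<mu>) \<in> basis_index" for g \<mu>
  proof (cases "h \<le> g")
    case True
    have \<mu>: "\<mu> \<in> {1..gdim M g}" and g: "g \<in> gsupp M"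
      using i by (simp add: basis_index_iff) (use i in \<open>auto simp: basis_index_def\<close>)
    have X: "gact M (Xpow (nexp (g - h))) (e (h, \<nu>)) = (\<Sum>\<mu>=1..gdim M g. kscale M (A (g, \<mu>) (h, \<nu>)) (e (g, \<mu>)))"
      using A_coeff[OF g _ True] j by (simp only: j_eq)
    moreover have "\<dots> \<in> gcomp M g" by (intro comp_sum comp_scale e_comp)
    ultimately have "Poly_Mapping.lookup (dual_basis M e (g, \<mu>) (gact M (Xpow (nexp (g - h))) (e (h, \<nu>)))) 0
        = A (g, \<mu>) (h, \<nu>)"
      by (simp only: dual_basis_lookup coord_comb[OF \<mu>])
    then show ?thesis
      using orbit_eq_cogen[OF dual_basis_comp ej, of g \<mu>] True by (simp only: if_True)
  next
    case False
    then show ?thesis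
      using pairing_vanishes[OF dual_basis_comp ej False] by (simp add: fun_eq_iff)
  qed
  then show ?thesis
    unfolding composite_apply m by (auto simp: fun_eq_iff j_eq)
qed

end

theorem proposition4p3:
  fixes M :: "('n::finite, 'k::field, 'm::ab_group_add) gmod"
    and d :: "'n deg \<Rightarrow> nat"
    and I J :: "('n deg \<times> nat) set"
    and e :: "'n deg \<times> nat \<Rightarrow> 'm"
    and A :: "'n deg \<times> nat \<Rightarrow> 'n deg \<times> nat \<Rightarrow> 'k"
  assumes M: "graded_module M" "finitely_generated M" "finitely_supported M"
    and d: "d = gdim M"
    and I: "I = (\<Union>g\<in>gsupp M. {g} \<times> {1..d g})"
    and J: "J = I"
    and e: "\<And>g. g \<in> gsupp M \<Longrightarrow> basis_of_comp M e g"
    and A_coeff: "\<And>g h \<nu>. g \<in> gsupp M \<Longrightarrow> (h, \<nu>) \<in> J \<Longrightarrow> h \<le> g \<Longrightarrow>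
        gact M (Xpow (nexp (g - h))) (e (h, \<nu>)) = (\<Sum>\<mu> = 1..d g. kscale M (A (g, \<mu>) (h, \<nu>)) (e (g, \<mu>)))"
    and A_zero: "\<And>g \<mu> h \<nu>. (g, \<mu>) \<in> I \<Longrightarrow> (h, \<nu>) \<in> J \<Longrightarrow> \<not> h \<le> g \<Longrightarrow> A (g, \<mu>) (h, \<nu>) = 0"
  shows "monomial_matrix I J fst fst A
    \<and> is_giso (free_mod J fst) (FM M) (F_ident M e)
    \<and> is_giso (EM M) (cofree_mod I fst) (E_ident M e)
    \<and> represents I J fst fst A (E_ident M e \<circ> phi M \<circ> F_ident M e)"
proof -
  interpret B: graded_basis M e
    using M e by (simp add: graded_basis_def graded_basis_axioms_def finitely_supported_def)
  have idx: "I = B.basis_index" "J = B.basis_index" by (simp_all add: I J d B.basis_index_def)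
  have "monomial_matrix I J fst fst A"
    using A_zero B.finite_basis_index by (auto simp: monomial_matrix_def idx)
  moreover have "represents I J fst fst A (E_ident M e \<circ> phi M \<circ> F_ident M e)"
    using B.composite_is_ghom B.composite_on_basis[of A, OF A_coeff[unfolded d idx]]
    by (simp only: represents_def idx) blast
  ultimately show ?thesis
    using B.F_ident_iso B.E_ident_iso by (simp only: idx)
qed

end
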